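(* Not every biconnected $1$-plane graph of maximum degree $4$ admits an $\mathrm{OC}_3$-layout; that is, there exists a biconnected $1$-plane graph of maximum degree $4$ that has no $\mathrm{OC}_3$-layout respecting its given embedding. Moreover, there is an infinite family of biconnected $1$-plane graphs of maximum degree $4$ requiring a linear number of edges of complexity at least $4$: there is a constant $c>0$ such that for every graph $G$ in the family, with $n$ vertices, every $\mathrm{OC}_4$-layout of $G$ respecting the given embedding contains at least $c\,n$ edges that are drawn with complexity at least $4$ (i.e. with at least $4$ segments, equivalently at least $3$ bends).
   Context: Graphs are finite and simple. A drawing maps vertices to distinct points of $\mathbb{R}^2$ and edges to curves joining the points of their endpoints; edges do not pass through other vertices, and edges with a common endpoint do not cross. A drawing is $1$-planar if each edge is crossed at most once. A $1$-plane graph is a graph together with a $1$-planar embedding, i.e. a $1$-planar drawing in the plane considered up to its combinatorial structure: the cyclic order of the edges around each vertex, which edges cross and in which order, and the outer (unbounded) face. A layout of a $1$-plane graph is always required to respect (realize) the given embedding. An orthogonal layout is a drawing in which each edge is drawn as a sequence of vertical and horizontal line segments, two consecutive segments of an edge meeting in a bend (a $90^\circ$ turn). Every vertex has four ports (North, South, East, West), each edge enters and leaves its end vertices at ports with a horizontal or vertical tangent, and no two edges incident to the same vertex use the same port. The complexity of an edge is the number of segments it consists of; the curve complexity of a drawing is the maximum number of segments used for an edge. An $\mathrm{OC}_k$-layout is an orthogonal layout with curve complexity at most $k$, i.e. with at most $k-1$ bends per edge. "Maximum degree $4$" means every vertex has degree at most $4$. *)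

theory Defs
  imports "HOL-Analysis.Analysis"
begin

section \<open>Finite simple graphs\<close>

record 'v graph =
  verts :: "'v set"
  edges :: "'v set set"

definition simple_graph :: "'v graph \<Rightarrow> bool" where
  "simple_graph G \<longleftrightarrow> finite (verts G) \<and> (\<forall>e\<in>edges G. e \<subseteq> verts G \<and> card e = 2)"

definition incident_edges :: "'v graph \<Rightarrow> 'v \<Rightarrow> 'v set set" where
  "incident_edges G v = {e \<in> edges G. v \<in> e}"

definition max_degree_le :: "nat \<Rightarrow> 'v graph \<Rightarrow> bool" where
  "max_degree_le d G \<longleftrightarrow> (\<forall>v\<in>verts G. card (incident_edges G v) \<le> d)"

definition connected_graph :: "'v graph \<Rightarrow> bool" where
  "connected_graph G \<longleftrightarrow> verts G \<noteq> {} \<and>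
     (\<forall>u\<in>verts G. \<forall>v\<in>verts G. (u, v) \<in> {(x, y). {x, y} \<in> edges G}\<^sup>*)"

definition delete_vertex :: "'v graph \<Rightarrow> 'v \<Rightarrow> 'v graph" where
  "delete_vertex G v = \<lparr>verts = verts G - {v}, edges = {e \<in> edges G. v \<notin> e}\<rparr>"

definition biconnected :: "'v graph \<Rightarrow> bool" where
  "biconnected G \<longleftrightarrow> 3 \<le> card (verts G) \<and> connected_graph G \<and>
     (\<forall>v\<in>verts G. connected_graph (delete_vertex G v))"

section \<open>Cyclic order of curves leaving a common point\<close>

text \<open>The plane is identified with the complex plane. For a curve \<open>g\<close> and a small radius
  \<open>r\<close>, \<open>exit_vector g r\<close> points from the start of \<open>g\<close> to the first point of \<open>g\<close> at
  distance \<open>r\<close> from it. For simple curves that share only their start point, the cyclic order of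
  their exit vectors is the same for all sufficiently small \<open>r\<close>; this order is the cyclic order
  in which the curves leave the common point. No smoothness of the curves is needed.\<close>

definition exit_vector :: "(real \<Rightarrow> complex) \<Rightarrow> real \<Rightarrow> complex" where
  "exit_vector g r = g (Inf {t \<in> {0..1}. dist (g 0) (g t) = r}) - g 0"

text \<open>\<open>ccw g1 g2 g3\<close>: turning counterclockwise around the common start point from \<open>g1\<close>, one
  meets \<open>g2\<close> strictly before \<open>g3\<close>.\<close>

definition ccw :: "(real \<Rightarrow> complex) \<Rightarrow> (real \<Rightarrow> complex) \<Rightarrow> (real \<Rightarrow> complex) \<Rightarrow> bool" where
  "ccw g1 g2 g3 \<longleftrightarrow>
     (\<forall>\<^sub>F r in at_right 0.
        0 < Arg2pi (exit_vector g2 r / exit_vector g1 r) \<and>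
        Arg2pi (exit_vector g2 r / exit_vector g1 r) < Arg2pi (exit_vector g3 r / exit_vector g1 r))"

section \<open>Drawings\<close>

text \<open>The direction in which \<open>curve D e\<close> traverses the edge \<open>e\<close> is arbitrary.\<close>

record 'v drawing =
  point :: "'v \<Rightarrow> complex"
  curve :: "'v set \<Rightarrow> real \<Rightarrow> complex"

text \<open>The curve of \<open>e\<close>, parametrised so that it starts at the end vertex \<open>u\<close>.\<close>

definition curve_from :: "'v drawing \<Rightarrow> 'v \<Rightarrow> 'v set \<Rightarrow> real \<Rightarrow> complex" where
  "curve_from D u e =
     (if pathstart (curve D e) = point D u then curve D e else reversepath (curve D e))"

text \<open>The part of the curve of \<open>e\<close> that leads from its point \<open>p\<close> to the end vertex \<open>u\<close>.\<close>

definition arm :: "'v drawing \<Rightarrow> complex \<Rightarrow> 'v set \<Rightarrow> 'v \<Rightarrow> real \<Rightarrow> complex" where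
  "arm D p e u = subpath (inv_into {0..1} (curve_from D u e) p) 0 (curve_from D u e)"

definition meet_at :: "'v graph \<Rightarrow> 'v drawing \<Rightarrow> 'v set \<Rightarrow> 'v set \<Rightarrow> complex \<Rightarrow> bool" where
  "meet_at G D e f p \<longleftrightarrow> e \<in> edges G \<and> f \<in> edges G \<and> e \<noteq> f \<and>
     p \<in> path_image (curve D e) \<inter> path_image (curve D f) - point D ` verts G"

text \<open>Two edges cross, rather than touch, at a common point if their four arms alternate around
  that point.\<close>

definition alternate_at :: "'v drawing \<Rightarrow> 'v set \<Rightarrow> 'v set \<Rightarrow> complex \<Rightarrow> bool" where
  "alternate_at D e f p \<longleftrightarrow>
     (\<exists>u u' v v'. e = {u, u'} \<and> f = {v, v'} \<and>
        ccw (arm D p e u) (arm D p f v) (arm D p e u') \<and>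
        ccw (arm D p e u') (arm D p f v') (arm D p e u))"

definition is_drawing :: "'v graph \<Rightarrow> 'v drawing \<Rightarrow> bool" where
  "is_drawing G D \<longleftrightarrow>
     inj_on (point D) (verts G) \<and>
     (\<forall>e\<in>edges G. arc (curve D e) \<and>
        {pathstart (curve D e), pathfinish (curve D e)} = point D ` e) \<and>
     (\<forall>e\<in>edges G. \<forall>v\<in>verts G. point D v \<in> path_image (curve D e) \<longrightarrow> v \<in> e) \<and>
     (\<forall>e f p. meet_at G D e f p \<longrightarrow> e \<inter> f = {} \<and> alternate_at D e f p)"

definition one_planar_drawing :: "'v graph \<Rightarrow> 'v drawing \<Rightarrow> bool" where
  "one_planar_drawing G D \<longleftrightarrow> is_drawing G D \<and>
     (\<forall>e f f' p p'. meet_at G D e f p \<and> meet_at G D e f' p' \<longrightarrow> f = f' \<and> p = p')"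

section \<open>Embeddings\<close>

text \<open>A 1-plane graph is represented by a graph with one drawing from the class of 1-planar
  drawings that realize its embedding; \<open>same_embedding\<close> below is the equivalence that defines
  these classes.\<close>

definition one_plane_graph :: "'v graph \<Rightarrow> 'v drawing \<Rightarrow> bool" where
  "one_plane_graph G D \<longleftrightarrow> simple_graph G \<and> one_planar_drawing G D"

definition drawn_set :: "'v graph \<Rightarrow> 'v drawing \<Rightarrow> complex set" where
  "drawn_set G D = point D ` verts G \<union> (\<Union>e\<in>edges G. path_image (curve D e))"

text \<open>The part of \<open>e\<close> between its end vertex \<open>u\<close> and the first crossing met from there (or the
  whole of \<open>e\<close> if it is not crossed).\<close>

definition edge_part :: "'v graph \<Rightarrow> 'v drawing \<Rightarrow> 'v \<Rightarrow> 'v set \<Rightarrow> complex set" where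
  "edge_part G D u e = curve_from D u e `
     {t \<in> {0..1}. \<forall>s\<in>{0..<t}. \<forall>f. \<not> meet_at G D e f (curve_from D u e s)}"

text \<open>The outer face is recorded combinatorially by the edge parts on its boundary.\<close>

definition outer_face_boundary :: "'v graph \<Rightarrow> 'v drawing \<Rightarrow> ('v \<times> 'v set) set" where
  "outer_face_boundary G D =
     {(u, e). e \<in> edges G \<and> u \<in> e \<and> edge_part G D u e \<subseteq> frontier (outside (drawn_set G D))}"

text \<open>The three conditions compare the cyclic order of the edges around each vertex, the pairs of
  crossing edges, and the outer face. The order of the crossings along an edge carries no
  information because an edge of a 1-planar drawing has at most one crossing.\<close>

definition same_embedding :: "'v graph \<Rightarrow> 'v drawing \<Rightarrow> 'v drawing \<Rightarrow> bool" where
  "same_embedding G D D' \<longleftrightarrow>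
     (\<forall>v\<in>verts G. \<forall>e1\<in>incident_edges G v. \<forall>e2\<in>incident_edges G v. \<forall>e3\<in>incident_edges G v.
        ccw (curve_from D v e1) (curve_from D v e2) (curve_from D v e3) \<longleftrightarrow>
        ccw (curve_from D' v e1) (curve_from D' v e2) (curve_from D' v e3)) \<and>
     (\<forall>e f. (\<exists>p. meet_at G D e f p) \<longleftrightarrow> (\<exists>p. meet_at G D' e f p)) \<and>
     outer_face_boundary G D = outer_face_boundary G D'"

definition respects_embedding :: "'v graph \<Rightarrow> 'v drawing \<Rightarrow> 'v drawing \<Rightarrow> bool" where
  "respects_embedding G D L \<longleftrightarrow> one_planar_drawing G L \<and> same_embedding G D L"

section \<open>Orthogonal layouts\<close>

fun polyline :: "complex list \<Rightarrow> real \<Rightarrow> complex" where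
  "polyline [] = linepath 0 0"
| "polyline [p] = linepath p p"
| "polyline [p, q] = linepath p q"
| "polyline (p # q # r # ps) = linepath p q +++ polyline (q # r # ps)"

definition horizontal :: "complex \<Rightarrow> complex \<Rightarrow> bool" where
  "horizontal p q \<longleftrightarrow> p \<noteq> q \<and> Im p = Im q"

definition vertical :: "complex \<Rightarrow> complex \<Rightarrow> bool" where
  "vertical p q \<longleftrightarrow> p \<noteq> q \<and> Re p = Re q"

text \<open>The first and last points of the list are the ends of the edge; the points in between are
  its bends, all of them proper.\<close>

definition orthogonal_chain :: "complex list \<Rightarrow> bool" where
  "orthogonal_chain ps \<longleftrightarrow> 2 \<le> length ps \<and>
     (\<forall>i. Suc i < length ps \<longrightarrow>
        horizontal (ps ! i) (ps ! Suc i) \<or> vertical (ps ! i) (ps ! Suc i)) \<and>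
     (\<forall>i. Suc (Suc i) < length ps \<longrightarrow>
        (horizontal (ps ! i) (ps ! Suc i) \<longleftrightarrow> vertical (ps ! Suc i) (ps ! Suc (Suc i))))"

text \<open>The direction (1, \<open>\<i>\<close>, -1 or -\<open>\<i>\<close>, that is East, North, West or South) in which an
  edge drawn as the chain \<open>ps\<close> leaves its end point \<open>z\<close>.\<close>

definition port :: "complex list \<Rightarrow> complex \<Rightarrow> complex" where
  "port ps z = (let qs = (if hd ps = z then ps else rev ps) in sgn (qs ! 1 - qs ! 0))"

definition orthogonal_layout ::
    "'v graph \<Rightarrow> 'v drawing \<Rightarrow> ('v set \<Rightarrow> complex list) \<Rightarrow> bool" where
  "orthogonal_layout G L C \<longleftrightarrow> is_drawing G L \<and>
     (\<forall>e\<in>edges G. orthogonal_chain (C e) \<and> curve L e = polyline (C e)) \<and>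
     (\<forall>v\<in>verts G. inj_on (\<lambda>e. port (C e) (point L v)) (incident_edges G v))"

definition complexity :: "('v set \<Rightarrow> complex list) \<Rightarrow> 'v set \<Rightarrow> nat" where
  "complexity C e = length (C e) - 1"

definition OC_layout ::
    "nat \<Rightarrow> 'v graph \<Rightarrow> 'v drawing \<Rightarrow> ('v set \<Rightarrow> complex list) \<Rightarrow> bool" where
  "OC_layout k G L C \<longleftrightarrow> orthogonal_layout G L C \<and> (\<forall>e\<in>edges G. complexity C e \<le> k)"

end

(* In the plane, take a triangle whose three corners have degree 4 with both remaining edges going
   inside. In an orthogonal layout, look at the highest, lowest, leftmost and rightmost points of the
   triangle. A corner cannot be one of them, because the edge leaving it through the corresponding
   port would escape from the triangle. So each of the four extremes is attained along an inner
   segment of one of the three sides, and some side has two inner segments, that is, at least four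
   segments.

   To use this linearly often, the two vertices inside the triangle are joined to the rest of the
   graph by two edges, each crossing one side of the triangle. Copies of this gadget are arranged in
   a ring. In every layout respecting the embedding, the rest of the ring avoids the triangle and
   reaches the outer face, so it lies outside; a connecting edge crosses the triangle exactly once, so
   its other end lies inside. Only the pairs of crossing edges and one edge of the outer face are
   needed from the embedding. *)

theory Submission
  imports Defs
begin

section \<open>Germs of arcs in orthogonal drawings\<close>

text \<open>Vertices 1 to 5 of a gadget span K5 minus the edge 15. Each corner of the triangle sees
  the other two corners and both inner vertices, hence has degree exactly 4, and each inner vertex
  has one port left for a connecting edge. Two inner vertices on the same side of the triangle force
  a further crossing, since otherwise a new vertex on the other side, joined to the corners, would
  complete a plane K(3,3); hence the crossing of 13 and 45.

  The obstacle is topological. A crossing is given as an alternation of arms at all small radii,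
  while the argument needs that it changes the side of a closed curve. Orthogonality helps: near any
  point an orthogonally drawn edge lies on the two axis-parallel lines through it, so the four arms
  of a crossing start as four straight rays, and a crossed triangle looks like a diameter of a small
  disc.

  That the embedding exists is a separate task, solved by an explicit straight-line drawing with
  integer coordinates, in which all crossings come down to finitely many sign computations.\<close>

definition axes :: "complex set" where
  "axes = {1, \<i>, -1, -\<i>}"

text \<open>The real inner product of \<open>z\<close> and \<open>d\<close>: for a unit
  \<open>d\<close>, the coordinate of \<open>z\<close> in direction \<open>d\<close>.
  Correspondingly \<open>Im (z * cnj d)\<close> is the coordinate in the perpendicular direction
  \<open>\<i> * d\<close>.\<close>

definition height :: "complex \<Rightarrow> complex \<Rightarrow> real" where
  "height d z = Re (z * cnj d)"

definition cross_at :: "complex \<Rightarrow> complex set" where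
  "cross_at x = {z. Re z = Re x \<or> Im z = Im x}"

text \<open>The set of times at distance \<open>r\<close> is closed and nonempty, so its infimum
  belongs to it. If all these times give the same point, the first one need not be
  identified.\<close>

lemma exit_vector_eqI:
  assumes "path h" "h 0 = x" "0 < r"
    and "\<exists>t\<in>{0..1}. dist x (h t) = r"
    and "\<And>t. t \<in> {0..1} \<Longrightarrow> dist x (h t) = r \<Longrightarrow> h t = x + w"
  shows "exit_vector h r = w"
proof -
  let ?S = "{t \<in> {0..1}. dist (h 0) (h t) = r}"
  have "continuous_on {0..1} (\<lambda>t. dist (h 0) (h t))"
    using assms(1) by (intro continuous_intros) (auto simp: path_def)
  then have "closed ?S"
    using continuous_closed_preimage[of "{0..1}" "\<lambda>t. dist (h 0) (h t)" "{r}"]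
    by (simp add: vimage_def Int_def)
  moreover have "?S \<noteq> {}" using assms(2,4) by auto
  moreover have "bdd_below ?S" by (rule bdd_belowI[of _ 0]) auto
  ultimately have "Inf ?S \<in> ?S" by (rule closed_contains_Inf[rotated 2])
  then have "h (Inf ?S) = x + w" using assms(2,5) by auto
  then show ?thesis unfolding exit_vector_def using assms(2) by simp
qed

lemma axis_ray:
  assumes "z \<in> cross_at x"
  shows "\<exists>d\<in>axes. z = x + of_real (dist x z) * d"
proof -
  consider "Re z = Re x" "Im z \<ge> Im x" | "Re z = Re x" "Im z \<le> Im x"
    | "Im z = Im x" "Re z \<ge> Re x" | "Im z = Im x" "Re z \<le> Re x"
    using assms unfolding cross_at_def by fastforce
  then have "z = x + of_real (dist x z) * \<i> \<or> z = x + of_real (dist x z) * -\<i> \<or>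
      z = x + of_real (dist x z) * 1 \<or> z = x + of_real (dist x z) * -1"
    by cases (simp_all add: complex_eq_iff dist_complex_def cmod_def)
  then show ?thesis unfolding axes_def by blast
qed

text \<open>Near \<open>x\<close> the arc without its start is a connected subset of the cross without its centre,
  hence lies on one of the four rays.\<close>

lemma arc_germ:
  assumes h: "arc h" "h 0 = x" and \<delta>: "0 < \<delta>" "path_image h \<inter> ball x \<delta> \<subseteq> cross_at x"
  obtains d \<epsilon> where "d \<in> axes" "0 < \<epsilon>"
    "\<And>r. 0 < r \<Longrightarrow> r < \<epsilon> \<Longrightarrow> x + of_real r * d \<in> path_image h"
    "\<And>r. 0 < r \<Longrightarrow> r < \<epsilon> \<Longrightarrow> exit_vector h r = of_real r * d"
proof -
  have ph: "path h" and inj: "inj_on h {0..1}" using h by (auto simp: arc_def)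
  then have cont: "continuous_on {0..1} h" by (simp add: path_def)
  obtain \<eta>0 where \<eta>0: "0 < \<eta>0" "\<And>t. t \<in> {0..1} \<Longrightarrow> dist t 0 < \<eta>0 \<Longrightarrow> dist (h t) (h 0) < \<delta>"
    using cont[unfolded continuous_on_iff] \<delta>(1) by (metis atLeastAtMost_iff zero_le_one order_refl)
  define \<eta> where "\<eta> = min 1 (\<eta>0 / 2)"
  have \<eta>: "0 < \<eta>" "\<eta> \<le> 1" "\<eta> < \<eta>0" using \<eta>0(1) by (auto simp: \<eta>_def)
  have ne: "h t \<noteq> x" if "0 < t" "t \<le> 1" for t
    using inj that h(2) unfolding inj_on_def by (metis atLeastAtMost_iff less_eq_real_def less_irrefl zero_le_one)
  have near: "h t \<in> cross_at x" if "0 < t" "t \<le> \<eta>" for t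
  proof -
    have "dist (h t) (h 0) < \<delta>" using that \<eta> \<eta>0(2)[of t] by auto
    then have "h t \<in> path_image h \<inter> ball x \<delta>"
      using that \<eta> h(2) by (auto simp: path_image_def dist_commute)
    then show ?thesis using \<delta>(2) by blast
  qed
  define S where "S = h ` {0<..\<eta>}"
  have cS: "connected S" unfolding S_def
    by (rule connected_continuous_image[OF continuous_on_subset[OF cont]]) (use \<eta> in auto)
  obtain d where d: "d \<in> axes" and hd: "h \<eta> = x + of_real (dist x (h \<eta>)) * d"
    using axis_ray[OF near[of \<eta>]] \<eta> by auto
  have dd: "d * cnj d = 1" using d by (auto simp: axes_def)
  have ray: "z = x + of_real (dist x z) * d" if z: "z \<in> S" for z
  proof -
    \<comment> \<open>\<open>U\<close> is the open quarter plane with apex \<open>x\<close> around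
      the ray in direction \<open>d\<close>, and \<open>V\<close> lies beyond its two bounding
      diagonals. The diagonals meet the cross only in \<open>x\<close>, which \<open>S\<close>
      avoids, so the connected set \<open>S\<close> stays in the part that contains
      \<open>h \<eta>\<close>.\<close>
    define U where "U = {z. height d (z - x) > \<bar>Im ((z - x) * cnj d)\<bar>}"
    define V where "V = {z. height d (z - x) < \<bar>Im ((z - x) * cnj d)\<bar>}"
    have oU: "open U" "open V" unfolding U_def V_def height_def
      by (intro open_Collect_less continuous_intros)+
    have "S \<subseteq> U \<union> V"
    proof
      fix y assume "y \<in> S"
      then obtain t where "0 < t" "t \<le> \<eta>" "y = h t" by (auto simp: S_def)
      then have "y \<in> cross_at x" "y \<noteq> x" using near ne \<eta> by auto
      then show "y \<in> U \<union> V" using d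
        by (auto simp: U_def V_def height_def axes_def cross_at_def complex_eq_iff)
    qed
    moreover have "h \<eta> \<in> U"
    proof -
      have "h \<eta> \<noteq> x" using ne \<eta> by auto
      then have "dist x (h \<eta>) > 0" by simp
      moreover have "(h \<eta> - x) * cnj d = of_real (dist x (h \<eta>))"
        using hd dd by (metis add_diff_cancel_left' mult.assoc mult.right_neutral)
      ultimately show ?thesis by (simp only: U_def height_def mem_Collect_eq) simp
    qed
    moreover have "h \<eta> \<in> S" using \<eta> by (auto simp: S_def)
    moreover have "U \<inter> V = {}" by (auto simp: U_def V_def)
    ultimately have "S \<inter> V = {}"
      using cS oU unfolding connected_def by (metis Int_assoc Int_commute disjoint_iff inf_bot_right)
    then have "z \<in> U" using z \<open>S \<subseteq> U \<union> V\<close> by auto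
    moreover have "z \<in> cross_at x" using z near by (auto simp: S_def)
    ultimately show ?thesis using d
      by (auto simp: U_def height_def axes_def cross_at_def complex_eq_iff dist_complex_def cmod_def)
  qed
  \<comment> \<open>The rest of the arc is compact and misses \<open>x\<close>, so it keeps a
    positive distance \<epsilon>. At smaller radii only the initial piece on the ray is
    seen.\<close>
  have "compact (h ` {\<eta>..1})"
    by (rule compact_continuous_image[OF continuous_on_subset[OF cont]]) (use \<eta> in auto)
  then have "closed (h ` {\<eta>..1})" by (rule compact_imp_closed)
  moreover have "x \<notin> h ` {\<eta>..1}"
  proof
    assume "x \<in> h ` {\<eta>..1}"
    then obtain t where "t \<in> {\<eta>..1}" "h t = x" by auto
    then show False using ne[of t] \<eta> by auto
  qed
  ultimately obtain \<epsilon> where \<epsilon>: "0 < \<epsilon>" "ball x \<epsilon> \<inter> h ` {\<eta>..1} = {}"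
    by (metis (no_types, lifting) Compl_iff disjoint_eq_subset_Compl open_Compl openE)
  have far: "\<epsilon> \<le> dist x (h t)" if "\<eta> \<le> t" "t \<le> 1" for t
    using \<epsilon>(2) that by (force simp: disjoint_iff)
  have on: "h t = x + of_real r * d" if "t \<in> {0..1}" "dist x (h t) = r" "0 < r" "r < \<epsilon>" for t r
  proof -
    have "0 < t" using that h(2) by (cases "t = 0") auto
    moreover have "t < \<eta>" using far[of t] that by force
    ultimately have "h t \<in> S" by (auto simp: S_def)
    then show ?thesis using ray that by metis
  qed
  have ex: "\<exists>t\<in>{0..1}. dist x (h t) = r" if "0 < r" "r < \<epsilon>" for r
  proof -
    have "continuous_on {0..1} (\<lambda>t. dist x (h t))" using cont by (intro continuous_intros)
    then show ?thesis
      using IVT'[of "\<lambda>t. dist x (h t)" 0 r 1] far[of 1] that h(2) \<eta> by force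
  qed
  show thesis
  proof (rule that[OF d \<epsilon>(1)])
    fix r :: real assume r: "0 < r" "r < \<epsilon>"
    then obtain t where t: "t \<in> {0..1}" "dist x (h t) = r" using ex by blast
    then show "x + of_real r * d \<in> path_image h" using on[OF t r] by (metis imageI path_image_def)
    show "exit_vector h r = of_real r * d"
      by (rule exit_vector_eqI[OF ph h(2) r(1) ex[OF r]]) (use on r in auto)
  qed
qed

text \<open>Turning from \<open>h1\<close> past \<open>k1\<close> to \<open>h2\<close> takes at
  least two quarter turns, and so does turning from \<open>h2\<close> past \<open>k2\<close> back to
  \<open>h1\<close>. A full turn has only four, so both take exactly two and \<open>k1\<close>,
  \<open>k2\<close> sit in the middle.\<close>

lemma ccw_axes:
  assumes "d1 \<in> axes" "d2 \<in> axes" "e1 \<in> axes" "e2 \<in> axes" "0 < \<epsilon>"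
    and "\<And>r. 0 < r \<Longrightarrow> r < \<epsilon> \<Longrightarrow> exit_vector h1 r = of_real r * d1"
    and "\<And>r. 0 < r \<Longrightarrow> r < \<epsilon> \<Longrightarrow> exit_vector h2 r = of_real r * d2"
    and "\<And>r. 0 < r \<Longrightarrow> r < \<epsilon> \<Longrightarrow> exit_vector k1 r = of_real r * e1"
    and "\<And>r. 0 < r \<Longrightarrow> r < \<epsilon> \<Longrightarrow> exit_vector k2 r = of_real r * e2"
    and "ccw h1 k1 h2" "ccw h2 k2 h1"
  shows "d2 = -d1 \<and> e1 = \<i> * d1 \<and> e2 = - \<i> * d1"
proof -
  have "\<forall>\<^sub>F r in at_right (0::real). r < \<epsilon>" "\<forall>\<^sub>F r in at_right (0::real). 0 < r"
    using assms(5) by (auto simp: eventually_at_right_less intro: eventually_at_right_real)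
       (use eventually_at_right_real[of 0 \<epsilon>] in \<open>auto elim: eventually_mono\<close>)
  with assms(10,11) have "\<forall>\<^sub>F r in at_right 0. 
      0 < Arg2pi (exit_vector k1 r / exit_vector h1 r) \<and>
      Arg2pi (exit_vector k1 r / exit_vector h1 r) < Arg2pi (exit_vector h2 r / exit_vector h1 r) \<and>
      0 < Arg2pi (exit_vector k2 r / exit_vector h2 r) \<and>
      Arg2pi (exit_vector k2 r / exit_vector h2 r) < Arg2pi (exit_vector h1 r / exit_vector h2 r) \<and>
      0 < r \<and> r < \<epsilon>"
    unfolding ccw_def by eventually_elim auto
  then obtain r where "0 < r" "r < \<epsilon>"
      "0 < Arg2pi (exit_vector k1 r / exit_vector h1 r)"
      "Arg2pi (exit_vector k1 r / exit_vector h1 r) < Arg2pi (exit_vector h2 r / exit_vector h1 r)"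
      "0 < Arg2pi (exit_vector k2 r / exit_vector h2 r)"
      "Arg2pi (exit_vector k2 r / exit_vector h2 r) < Arg2pi (exit_vector h1 r / exit_vector h2 r)"
    using eventually_happens'[OF trivial_limit_at_right_real] by (smt (verit))
  then have *: "0 < Arg2pi (e1 / d1)" "Arg2pi (e1 / d1) < Arg2pi (d2 / d1)"
      "0 < Arg2pi (e2 / d2)" "Arg2pi (e2 / d2) < Arg2pi (d1 / d2)"
    using assms(6-9)[of r] by auto
  have A: "Arg2pi 1 = 0" "Arg2pi \<i> = pi / 2" "Arg2pi (-1) = pi" "Arg2pi (-\<i>) = 3 * pi / 2"
  proof -
    show "Arg2pi 1 = 0" using Arg2pi_of_real[of 1] by simp
    show "Arg2pi (-1) = pi" using Arg2pi_of_real[of "-1"] by simp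
    show i: "Arg2pi \<i> = pi / 2" by (rule Arg2pi_unique[of 1]) (use cis_pi_half cis_conv_exp[of "pi / 2"] in auto)
    have "Arg2pi (-\<i>) = Arg2pi (inverse \<i>)" by simp
    also have "\<dots> = 2 * pi - Arg2pi \<i>" by (subst Arg2pi_inverse) (auto simp: complex_is_Real_iff)
    finally show "Arg2pi (-\<i>) = 3 * pi / 2" using i by simp
  qed
  have "0 \<notin> axes" by (simp add: axes_def)
  then have nz: "d1 \<noteq> 0" "d2 \<noteq> 0" using assms(1,2) by blast+
  have q: "v / w \<in> axes" if "v \<in> axes" "w \<in> axes" for v w
    using that unfolding axes_def by (elim insertE emptyE) simp_all
  have large: "w = -1 \<or> w = -\<i>"
    if "0 < Arg2pi v" "Arg2pi v < Arg2pi w" "v \<in> axes" "w \<in> axes" for v w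
    using that unfolding axes_def by (elim insertE emptyE) (simp_all add: A)
  have "d2 / d1 = -1 \<or> d2 / d1 = -\<i>" by (rule large[OF *(1,2)]) (use q assms(1-4) in blast)+
  moreover have "d1 / d2 = -1 \<or> d1 / d2 = -\<i>" by (rule large[OF *(3,4)]) (use q assms(1-4) in blast)+
  moreover have "d2 / d1 * (d1 / d2) = 1" using nz by simp
  moreover have "w = -1" if "w = -1 \<or> w = -\<i>" "v = -1 \<or> v = -\<i>" "w * v = 1" for v w
    using that by auto
  ultimately have d21: "d2 / d1 = -1" by blast
  then have d2: "d2 = - d1" using nz by (simp add: field_simps)
  have small: "v = \<i>" if "0 < Arg2pi v" "Arg2pi v < pi" "v \<in> axes" for v
    using that unfolding axes_def by (elim insertE emptyE) (simp_all add: A)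
  have "d1 / d2 = -1" using d2 nz by simp
  then have "e1 / d1 = \<i>" "e2 / d2 = \<i>"
    using small[of "e1 / d1"] small[of "e2 / d2"] q assms(1-4) * A(3) d21 by auto
  then have "e1 = \<i> * d1" "e2 = \<i> * d2" using nz by (metis nonzero_eq_divide_eq)+
  then show ?thesis using d2 by simp
qed

section \<open>Extremal segments of orthogonal chains\<close>

lemma polyline_ends:
  assumes "ps \<noteq> []"
  shows "pathstart (polyline ps) = hd ps" "pathfinish (polyline ps) = last ps"
  using assms by (induction ps rule: polyline.induct) auto

lemma path_image_polyline:
  assumes "2 \<le> length ps"
  shows "path_image (polyline ps) = (\<Union>j\<in>{j. Suc j < length ps}. closed_segment (ps ! j) (ps ! Suc j))"
  using assms
proof (induction ps rule: polyline.induct)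
  case (3 p q)
  have "{j. Suc j < length [p, q]} = {0}" by auto
  then show ?case by simp
next
  case (4 p q r ps)
  have "{j. Suc j < length (p # q # r # ps)} = insert 0 (Suc ` {j. Suc j < length (q # r # ps)})"
    by (auto simp: image_iff less_Suc_eq_0_disj)
  moreover have "pathfinish (linepath p q) = pathstart (polyline (q # r # ps))"
    using polyline_ends(1)[of "q # r # ps"] by simp
  ultimately show ?case using 4 by (simp add: path_image_join)
qed auto

text \<open>A segment through \<open>x\<close> lies on one of the two axis-parallel lines through
  \<open>x\<close>; a segment missing \<open>x\<close> is closed and avoids a neighbourhood of
  \<open>x\<close>. There are finitely many segments.\<close>

lemma orthogonal_chain_cross:
  assumes "orthogonal_chain ps"
  obtains \<delta> where "0 < \<delta>" "path_image (polyline ps) \<inter> ball x \<delta> \<subseteq> cross_at x"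
proof -
  have len: "2 \<le> length ps" using assms by (simp add: orthogonal_chain_def)
  have "\<forall>\<^sub>F z in nhds x. z \<in> closed_segment (ps ! j) (ps ! Suc j) \<longrightarrow> z \<in> cross_at x"
    if j: "Suc j < length ps" for j
  proof (cases "x \<in> closed_segment (ps ! j) (ps ! Suc j)")
    case True
    have "horizontal (ps ! j) (ps ! Suc j) \<or> vertical (ps ! j) (ps ! Suc j)"
      using assms j by (simp add: orthogonal_chain_def)
    then have "closed_segment (ps ! j) (ps ! Suc j) \<subseteq> cross_at x"
    proof
      assume "horizontal (ps ! j) (ps ! Suc j)"
      then have "closed_segment (ps ! j) (ps ! Suc j) \<subseteq> {z. Im z = Im (ps ! j)}"
        by (auto simp: closed_segment_same_Im horizontal_def)
      then show ?thesis using subsetD[OF _ True] unfolding cross_at_def by (smt (verit) Collect_mono mem_Collect_eq subset_iff)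
    next
      assume "vertical (ps ! j) (ps ! Suc j)"
      then have "closed_segment (ps ! j) (ps ! Suc j) \<subseteq> {z. Re z = Re (ps ! j)}"
        by (auto simp: closed_segment_same_Re vertical_def)
      then show ?thesis using subsetD[OF _ True] unfolding cross_at_def by (smt (verit) Collect_mono mem_Collect_eq subset_iff)
    qed
    then show ?thesis by (simp add: subset_iff)
  next
    case False
    then have "\<forall>\<^sub>F z in nhds x. z \<in> - closed_segment (ps ! j) (ps ! Suc j)"
      by (intro eventually_nhds_in_open) auto
    then show ?thesis by eventually_elim simp
  qed
  moreover have "finite {j. Suc j < length ps}" by (rule finite_subset[of _ "{..<length ps}"]) auto
  ultimately have "\<forall>\<^sub>F z in nhds x. \<forall>j\<in>{j. Suc j < length ps}.
      z \<in> closed_segment (ps ! j) (ps ! Suc j) \<longrightarrow> z \<in> cross_at x"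
    by (intro eventually_ball_finite) auto
  then obtain \<delta> where "0 < \<delta>" "\<And>z. dist z x < \<delta> \<Longrightarrow> \<forall>j\<in>{j. Suc j < length ps}.
      z \<in> closed_segment (ps ! j) (ps ! Suc j) \<longrightarrow> z \<in> cross_at x"
    unfolding eventually_nhds_metric by blast
  then have "path_image (polyline ps) \<inter> ball x \<delta> \<subseteq> cross_at x"
    unfolding path_image_polyline[OF len] by (fastforce simp: dist_commute)
  with \<open>0 < \<delta>\<close> show thesis by (rule that)
qed

lemma segment_height_max:
  assumes "z \<in> closed_segment p q" "height d p \<le> height d z" "height d q \<le> height d z"
  shows "height d p = height d z \<or> height d q = height d z"
proof (rule ccontr)
  assume "\<not> ?thesis"
  with assms have less: "height d p < height d z" "height d q < height d z" by auto
  obtain u where u: "0 \<le> u" "u \<le> 1" "z = (1 - u) *\<^sub>R p + u *\<^sub>R q"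
    using assms(1) by (auto simp: closed_segment_def)
  have "height d z = (1 - u) * height d p + u * height d q"
    by (simp add: u(3) height_def algebra_simps)
  moreover have "(1 - u) * height d p + u * height d q < height d z"
    using convex_bound_lt[OF less, of "1 - u" u] u by simp
  ultimately show False by simp
qed

text \<open>Index \<open>j\<close> stands for the segment between the points \<open>j\<close> and
  \<open>Suc j\<close>. The index bounds exclude the first and the last segment, those that end at
  vertices.\<close>

definition extremal_at :: "complex list \<Rightarrow> complex \<Rightarrow> real \<Rightarrow> nat \<Rightarrow> bool" where
  "extremal_at ps d M j \<longleftrightarrow> 0 < j \<and> Suc (Suc j) < length ps \<and>
     height d (ps ! j) = M \<and> height d (ps ! Suc j) = M"

text \<open>The maximal height is attained at a point of the list, and this point is a bend because
  both ends are lower. One of the two segments at a bend is perpendicular to \<open>d\<close>, so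
  its other point has the same height and is no end either.\<close>

lemma extremal_segment:
  assumes ps: "orthogonal_chain ps" and d: "d \<in> axes"
    and le: "\<And>z. z \<in> path_image (polyline ps) \<Longrightarrow> height d z \<le> M"
    and t: "t \<in> path_image (polyline ps)" "height d t = M"
    and ends: "height d (hd ps) < M" "height d (last ps) < M"
  shows "\<exists>j. extremal_at ps d M j"
proof -
  have len: "2 \<le> length ps" using ps by (simp add: orthogonal_chain_def)
  have le': "height d (ps ! k) \<le> M" if "k < length ps" for k
  proof -
    have "ps ! k \<in> path_image (polyline ps)"
    proof (cases "Suc k < length ps")
      case True
      then show ?thesis by (auto simp: path_image_polyline[OF len])
    next
      case False
      then have "Suc (k - 1) < length ps" "Suc (k - 1) = k" using that len by auto
      then show ?thesis by (auto simp: path_image_polyline[OF len] intro!: exI[of _ "k - 1"])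
    qed
    then show ?thesis by (rule le)
  qed
  obtain i where i: "Suc i < length ps" "t \<in> closed_segment (ps ! i) (ps ! Suc i)"
    using t(1) by (auto simp: path_image_polyline[OF len])
  then have "height d (ps ! i) = M \<or> height d (ps ! Suc i) = M"
    using segment_height_max[OF i(2), of d] t(2) le' by auto
  then obtain k where k: "k < length ps" "height d (ps ! k) = M" using i(1) by (metis Suc_lessD)
  have ne: "ps \<noteq> []" using len by auto
  have bend: "k \<noteq> 0" "Suc k \<noteq> length ps"
  proof -
    show "k \<noteq> 0" using k ends(1) by (metis hd_conv_nth[OF ne] less_irrefl)
    show "Suc k \<noteq> length ps"
    proof
      assume "Suc k = length ps"
      then have "last ps = ps ! k" by (simp add: last_conv_nth[OF ne] flip: \<open>Suc k = length ps\<close>)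
      then show False using k ends(2) by simp
    qed
  qed
  then obtain k' where k': "k = Suc k'" by (cases k) auto
  have "Suc (Suc k') < length ps" using bend k k' by simp
  then have "horizontal (ps ! k') (ps ! k) \<longleftrightarrow> vertical (ps ! k) (ps ! Suc k)"
      "horizontal (ps ! k') (ps ! k) \<or> vertical (ps ! k') (ps ! k)"
      "horizontal (ps ! k) (ps ! Suc k) \<or> vertical (ps ! k) (ps ! Suc k)"
    using ps unfolding orthogonal_chain_def k' by (blast dest: Suc_lessD)+
  then have "height d (ps ! k') = M \<or> height d (ps ! Suc k) = M"
    using k(2) d by (auto simp: height_def axes_def horizontal_def vertical_def)
  then show ?thesis
  proof
    assume *: "height d (ps ! k') = M"
    then have "k' \<noteq> 0" using ends(1) by (metis hd_conv_nth[OF ne] less_irrefl)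
    then show ?thesis using * k k' bend unfolding extremal_at_def by (intro exI[of _ k']) auto
  next
    assume *: "height d (ps ! Suc k) = M"
    have "Suc (Suc k) \<noteq> length ps"
    proof
      assume "Suc (Suc k) = length ps"
      then have "last ps = ps ! Suc k" by (simp add: last_conv_nth[OF ne] flip: \<open>Suc (Suc k) = length ps\<close>)
      then show False using * ends(2) by simp
    qed
    then show ?thesis using * k k' bend unfolding extremal_at_def by (intro exI[of _ k]) auto
  qed
qed

text \<open>One segment cannot serve two directions: both would be perpendicular to it, hence
  opposite, and the start of the chain would have to lie strictly below and strictly above the same
  line. Two different inner segments have indices at least 1 and 2, which takes five points, that
  is, four segments.\<close>

lemma two_extremes:
  assumes ps: "orthogonal_chain ps" and d: "d \<in> axes" "d' \<in> axes" "d \<noteq> d'"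
    and j: "extremal_at ps d (M d) j" "extremal_at ps d' (M d') j'"
    and ends: "\<And>d. d \<in> axes \<Longrightarrow> height d (hd ps) < M d"
  shows "5 \<le> length ps"
proof -
  have "j \<noteq> j'"
  proof
    assume jj: "j = j'"
    have "Suc j < length ps" using j(1) by (simp add: extremal_at_def)
    then have "ps ! j \<noteq> ps ! Suc j"
      using ps by (auto simp: orthogonal_chain_def horizontal_def vertical_def)
    have h: "height d (ps ! j) = M d" "height d (ps ! Suc j) = M d"
       "height d' (ps ! j) = M d'" "height d' (ps ! Suc j) = M d'"
      using j jj by (auto simp: extremal_at_def)
    have "height d (hd ps) < M d" "height d' (hd ps) < M d'" using ends d by auto
    have "Re (ps ! j) \<noteq> Re (ps ! Suc j) \<or> Im (ps ! j) \<noteq> Im (ps ! Suc j)"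
      using \<open>ps ! j \<noteq> ps ! Suc j\<close> by (simp add: complex_eq_iff)
    then have "d' = - d"
    proof
      assume "Re (ps ! j) \<noteq> Re (ps ! Suc j)"
      then have "d = \<i> \<or> d = -\<i>" "d' = \<i> \<or> d' = -\<i>"
        using d(1,2) h by (auto simp: axes_def height_def)
      then show ?thesis using d(3) by auto
    next
      assume "Im (ps ! j) \<noteq> Im (ps ! Suc j)"
      then have "d = 1 \<or> d = -1" "d' = 1 \<or> d' = -1"
        using d(1,2) h by (auto simp: axes_def height_def)
      then show ?thesis using d(3) by auto
    qed
    then have "M d' = - M d" "height d' (hd ps) = - height d (hd ps)"
      using h by (auto simp: height_def)
    then show False using \<open>height d (hd ps) < M d\<close> \<open>height d' (hd ps) < M d'\<close> by simp
  qed
  then show ?thesis using j by (auto simp: extremal_at_def)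
qed

lemma long_chain:
  assumes E: "finite E" "card E \<le> 3"
    and C: "\<And>e. e \<in> E \<Longrightarrow> orthogonal_chain (C e)"
    and le: "\<And>e d z. e \<in> E \<Longrightarrow> d \<in> axes \<Longrightarrow> z \<in> path_image (polyline (C e)) \<Longrightarrow> height d z \<le> M d"
    and attained: "\<And>d. d \<in> axes \<Longrightarrow> \<exists>e\<in>E. \<exists>z\<in>path_image (polyline (C e)). height d z = M d"
    and ends: "\<And>e d. e \<in> E \<Longrightarrow> d \<in> axes \<Longrightarrow> height d (hd (C e)) < M d \<and> height d (last (C e)) < M d"
  shows "\<exists>e\<in>E. 5 \<le> length (C e)"
proof -
  have "\<exists>e\<in>E. \<exists>j. extremal_at (C e) d (M d) j" if d: "d \<in> axes" for d
  proof -
    obtain e z where ez: "e \<in> E" "z \<in> path_image (polyline (C e))" "height d z = M d"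
      using attained[OF d] by blast
    have "\<exists>j. extremal_at (C e) d (M d) j"
      using extremal_segment[OF C[OF ez(1)] d le[OF ez(1) d] ez(2,3)] ends[OF ez(1) d] by blast
    then show ?thesis using ez(1) by blast
  qed
  then obtain f where f: "\<And>d. d \<in> axes \<Longrightarrow> f d \<in> E \<and> (\<exists>j. extremal_at (C (f d)) d (M d) j)" by metis
  have "card axes = 4" by (simp add: axes_def complex_eq_iff)
  moreover have "card (f ` axes) \<le> 3"
    using card_mono[OF E(1), of "f ` axes"] f E(2) by fastforce
  ultimately have "\<not> inj_on f axes" using card_image by fastforce
  then obtain d d' where dd: "d \<in> axes" "d' \<in> axes" "d \<noteq> d'" "f d = f d'" unfolding inj_on_def by blast
  then obtain j j' where "extremal_at (C (f d)) d (M d) j" "extremal_at (C (f d)) d' (M d') j'"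
    using f by metis
  then have "5 \<le> length (C (f d))"
    using two_extremes[OF C dd(1-3)] ends f dd(1) by blast
  then show ?thesis using f dd(1) by blast
qed

text \<open>Four edges with distinct ports use all four directions, so one of them leaves
  \<open>p\<close> in direction \<open>d\<close> and contains points strictly higher than
  \<open>p\<close>.\<close>

lemma port_height:
  assumes card: "card I = 4" and inj: "inj_on (\<lambda>e. port (C e) p) I"
    and C: "\<And>e. e \<in> I \<Longrightarrow> orthogonal_chain (C e) \<and> (hd (C e) = p \<or> last (C e) = p)"
    and le: "\<And>e z. e \<in> I \<Longrightarrow> z \<in> path_image (polyline (C e)) \<Longrightarrow> height d z \<le> M"
    and d: "d \<in> axes"
  shows "height d p < M"
proof -
  have dir: "port (C e) p \<in> axes \<and> (\<exists>k>0. p + of_real k * port (C e) p \<in> path_image (polyline (C e)))"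
    if e: "e \<in> I" for e
  proof -
    define qs where "qs = (if hd (C e) = p then C e else rev (C e))"
    have oc: "orthogonal_chain (C e)" and he: "hd (C e) = p \<or> last (C e) = p" using C e by auto
    then have len: "2 \<le> length (C e)" by (simp add: orthogonal_chain_def)
    have ne: "C e \<noteq> []" using len by auto
    then have q0: "qs ! 0 = p" using he
      by (auto simp: qs_def hd_rev simp flip: hd_conv_nth)
    define q where "q = qs ! 1"
    have seg: "\<exists>i. Suc i < length (C e) \<and> (p = C e ! i \<and> q = C e ! Suc i \<or> q = C e ! i \<and> p = C e ! Suc i)"
    proof (cases "hd (C e) = p")
      case True
      then show ?thesis using q0 len by (intro exI[of _ 0]) (auto simp: q_def qs_def)
    next
      case False
      then have "qs = rev (C e)" by (simp add: qs_def)
      moreover have "rev (C e) ! 0 = C e ! Suc (length (C e) - 2)" "rev (C e) ! 1 = C e ! (length (C e) - 2)"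
        using len ne by (auto simp: rev_nth Suc_diff_Suc numeral_2_eq_2)
      ultimately have "q = C e ! (length (C e) - 2)" "p = C e ! (Suc (length (C e) - 2))"
        using q0 by (simp_all add: q_def)
      then show ?thesis using len by (intro exI[of _ "length (C e) - 2"]) auto
    qed
    then obtain i where i: "Suc i < length (C e)"
      "p = C e ! i \<and> q = C e ! Suc i \<or> q = C e ! i \<and> p = C e ! Suc i" by blast
    have hv: "p \<noteq> q \<and> (Re p = Re q \<or> Im p = Im q)"
      using oc i by (auto simp: orthogonal_chain_def horizontal_def vertical_def)
    have qin: "q \<in> path_image (polyline (C e))"
      using i by (auto simp: path_image_polyline[OF len])
    have port: "port (C e) p = sgn (q - p)"
      by (simp add: port_def q_def qs_def[symmetric] q0 Let_def)
    have "q = p + of_real (dist p q) * sgn (q - p)"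
      using hv by (simp add: sgn_div_norm dist_norm norm_minus_commute scaleR_conv_of_real field_simps)
    moreover have "sgn (q - p) \<in> axes"
    proof -
      obtain d where "d \<in> axes" "q = p + of_real (dist p q) * d"
        using axis_ray[of q p] hv by (auto simp: cross_at_def)
      then show ?thesis using hv \<open>q = p + of_real (dist p q) * sgn (q - p)\<close>
        by (metis add_left_cancel dist_eq_0_iff mult_cancel_left of_real_eq_0_iff)
    qed
    moreover have "0 < dist p q" using hv by simp
    ultimately show ?thesis using qin port by metis
  qed
  have "card axes = 4" "finite axes" by (auto simp: axes_def complex_eq_iff)
  moreover have "card ((\<lambda>e. port (C e) p) ` I) = 4" using card_image[OF inj] card by simp
  moreover have "(\<lambda>e. port (C e) p) ` I \<subseteq> axes" using dir by blast
  ultimately have "(\<lambda>e. port (C e) p) ` I = axes" by (simp add: card_subset_eq)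
  then have "d \<in> (\<lambda>e. port (C e) p) ` I" using d by (simp only:)
  then obtain e where e: "e \<in> I" "port (C e) p = d" by (elim imageE) simp
  then obtain k where k: "0 < k" "p + of_real k * d \<in> path_image (polyline (C e))" using dir by metis
  have "height d (p + of_real k * d) = height d p + k"
    using d by (auto simp: axes_def height_def algebra_simps)
  then show ?thesis using le[OF e(1) k(2)] k(1) by linarith
qed

section \<open>Crossings and the sides of a closed curve\<close>

lemma curve_from_props:
  assumes D: "is_drawing G D" and e: "e \<in> edges G" and u: "u \<in> e"
  shows "arc (curve_from D u e)" "path_image (curve_from D u e) = path_image (curve D e)"
    "pathstart (curve_from D u e) = point D u"
proof -
  have "arc (curve D e)" and ends: "{pathstart (curve D e), pathfinish (curve D e)} = point D ` e"
    using D e by (auto simp: is_drawing_def)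
  then show "arc (curve_from D u e)" "path_image (curve_from D u e) = path_image (curve D e)"
    by (auto simp: curve_from_def arc_reversepath)
  have "point D u \<in> {pathstart (curve D e), pathfinish (curve D e)}" using ends u by blast
  then show "pathstart (curve_from D u e) = point D u"
    by (auto simp: curve_from_def)
qed

lemma edge_ends_distinct:
  assumes "is_drawing G D" "{u, v} \<in> edges G"
  shows "u \<noteq> v" "point D u \<noteq> point D v"
proof -
  have "arc (curve D {u, v})"
    "{pathstart (curve D {u, v}), pathfinish (curve D {u, v})} = {point D u, point D v}"
    using assms by (auto simp: is_drawing_def)
  then show "point D u \<noteq> point D v"
    using arc_distinct_ends by (metis doubleton_eq_iff)
  then show "u \<noteq> v" by auto
qed

lemma pathfinish_curve_from:
  assumes D: "is_drawing G D" and e: "{u, v} \<in> edges G"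
  shows "pathfinish (curve_from D u {u, v}) = point D v"
proof -
  have "{pathstart (curve D {u, v}), pathfinish (curve D {u, v})} = {point D u, point D v}"
    using D e by (auto simp: is_drawing_def)
  then show ?thesis
    using edge_ends_distinct(2)[OF D e] by (auto simp: curve_from_def doubleton_eq_iff)
qed

lemma point_on_edge:
  assumes "is_drawing G D" "e \<in> edges G" "u \<in> e"
  shows "point D u \<in> path_image (curve D e)"
  using curve_from_props[OF assms] pathstart_in_path_image by metis

lemma connected_arc_minus_start:
  assumes "arc g"
  shows "connected (path_image g - {g 0})"
proof -
  have inj: "inj_on g {0..1}" and cont: "continuous_on {0..1} g"
    using assms by (auto simp: arc_def path_def)
  have "g ` ({0..1} - {0}) = g ` {0..1} - g ` {0}" by (rule inj_on_image_set_diff[OF inj]) auto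
  moreover have "{0..1} - {0} = {0<..1::real}" by auto
  moreover have "connected (g ` {0<..1})"
    by (intro connected_continuous_image continuous_on_subset[OF cont]) auto
  ultimately show ?thesis by (simp add: path_image_def)
qed

lemma connected_edge_minus_end:
  assumes D: "is_drawing G D" and e: "e \<in> edges G" "u \<in> e"
  shows "connected (path_image (curve D e) - {point D u})"
proof -
  let ?g = "curve_from D u e"
  have g: "arc ?g" "path_image ?g = path_image (curve D e)" "?g 0 = point D u"
    using curve_from_props[OF D e] by (auto simp: pathstart_def)
  show ?thesis using connected_arc_minus_start[OF g(1)] g by simp
qed

lemma arm_props:
  assumes D: "is_drawing G D" and e: "e \<in> edges G" "u \<in> e"
    and p: "p \<in> path_image (curve D e)" "p \<noteq> point D u"
  shows "arc (arm D p e u)" "arm D p e u 0 = p" "point D u \<in> path_image (arm D p e u)"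
    "path_image (arm D p e u) \<subseteq> path_image (curve D e)"
proof -
  let ?g = "curve_from D u e"
  define t where "t = inv_into {0..1} ?g p"
  note g = curve_from_props[OF D e]
  have "p \<in> ?g ` {0..1}" using p(1) g(2) by (simp add: path_image_def)
  then have t: "t \<in> {0..1}" "?g t = p" unfolding t_def by (rule inv_into_into, rule f_inv_into_f)
  have "t \<noteq> 0" using t(2) p(2) g(3) by (auto simp: pathstart_def)
  have arm: "arm D p e u = subpath t 0 ?g" by (simp add: arm_def t_def)
  show "arc (arm D p e u)" unfolding arm
    using g(1) t(1) \<open>t \<noteq> 0\<close> by (intro arc_simple_path_subpath arc_imp_simple_path)
      (auto simp: arc_def inj_on_def)
  show "arm D p e u 0 = p" using t(2) by (simp add: arm subpath_def)
  show "point D u \<in> path_image (arm D p e u)"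
    using g(3) t(1) by (auto simp: arm path_image_subpath pathstart_def intro!: image_eqI[of _ _ 0])
  show "path_image (arm D p e u) \<subseteq> path_image (curve D e)"
    using path_image_subpath_subset[of t 0 ?g] t(1) g(2) by (simp add: arm)
qed

lemma same_side:
  assumes "connected S" "S \<inter> J = {}" "a \<in> S" "b \<in> S"
  shows "a \<in> inside J \<Longrightarrow> b \<in> inside J" "a \<in> outside J \<Longrightarrow> b \<in> outside J"
proof -
  have "connected_component (- J) a b"
    using assms by (intro connected_componentI[of S]) auto
  then show "a \<in> inside J \<Longrightarrow> b \<in> inside J" "a \<in> outside J \<Longrightarrow> b \<in> outside J"
    using inside_same_component outside_same_component by metis+
qed

text \<open>For a unit \<open>w\<close> the condition cuts the disc along its diameter in direction
  \<open>cnj w\<close>; \<open>w\<close> and \<open>- w\<close> give the two open halves.\<close>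

lemma convex_halfball:
  "convex {z \<in> ball p \<epsilon>. 0 < Im ((z - p) * w)}"
proof -
  have "{z. 0 < Im ((z - p) * w)} = {z. Im (p * w) < (Complex (Im w) (Re w)) \<bullet> z}"
    by (auto simp: inner_complex_def algebra_simps)
  then have "convex {z. 0 < Im ((z - p) * w)}" by (simp add: convex_halfspace_gt)
  then have "convex (ball p \<epsilon> \<inter> {z. 0 < Im ((z - p) * w)})" by (intro convex_Int convex_ball)
  then show ?thesis by (simp only: Int_def mem_Collect_eq)
qed

lemma arm_germ:
  assumes D: "is_drawing G D" and e: "e \<in> edges G" "x \<in> e"
    and p: "p \<in> path_image (curve D e)" "p \<noteq> point D x"
    and ps: "orthogonal_chain ps" "curve D e = polyline ps"
  obtains d \<epsilon> where "d \<in> axes" "0 < \<epsilon>"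
    "\<And>r. 0 < r \<Longrightarrow> r < \<epsilon> \<Longrightarrow> p + of_real r * d \<in> path_image (arm D p e x)"
    "\<And>r. 0 < r \<Longrightarrow> r < \<epsilon> \<Longrightarrow> exit_vector (arm D p e x) r = of_real r * d"
proof -
  obtain \<delta> where \<delta>: "0 < \<delta>" "path_image (curve D e) \<inter> ball p \<delta> \<subseteq> cross_at p"
    using orthogonal_chain_cross[OF ps(1)] ps(2) by metis
  note arm = arm_props[OF D e p]
  have "path_image (arm D p e x) \<inter> ball p \<delta> \<subseteq> cross_at p" using arm(4) \<delta>(2) by blast
  from arc_germ[OF arm(1,2) \<delta>(1) this] that show thesis by metis
qed

text \<open>Near \<open>p\<close> the set \<open>J\<close> is a diameter of a small disc, and the
  two arms of \<open>f\<close> start into different halves of it. If both ends of \<open>f\<close>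
  were outside, both half discs would be outside too, leaving no inside point near \<open>p\<close>,
  although \<open>p\<close> is a frontier point of the inside.\<close>

lemma crossing_separates:
  assumes G: "simple_graph G" and D: "is_drawing G L" and m: "meet_at G L e f p"
    and Ce: "orthogonal_chain ps" "curve L e = polyline ps"
    and Cf: "orthogonal_chain qs" "curve L f = polyline qs"
    and J: "J = path_image (curve L e) \<union> B" "closed B" "p \<notin> B"
    and fr: "p \<in> frontier (inside J)" "p \<in> frontier (outside J)"
    and f: "path_image (curve L f) \<inter> J \<subseteq> {p}" "f = {v, v'}"
    and v: "point L v \<in> outside J"
  shows "point L v' \<in> inside J"
proof -
  have ef: "e \<in> edges G" "f \<in> edges G"
    and pin: "p \<in> path_image (curve L e)" "p \<in> path_image (curve L f)"
    and al: "alternate_at L e f p"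
    using m D by (auto simp: meet_at_def is_drawing_def)
  obtain u u' w w' where lab: "e = {u, u'}" "f = {w, w'}"
    and cc: "ccw (arm L p e u) (arm L p f w) (arm L p e u')"
            "ccw (arm L p e u') (arm L p f w') (arm L p e u)"
    using al unfolding alternate_at_def by metis
  have pJ: "p \<in> J" using J(1) pin by auto
  have "p \<notin> point L ` verts G" "e \<subseteq> verts G" "f \<subseteq> verts G"
    using m G ef by (auto simp: meet_at_def simple_graph_def)
  then have nve: "x \<in> e \<Longrightarrow> p \<noteq> point L x" and nvf: "x \<in> f \<Longrightarrow> p \<noteq> point L x" for x
    by blast+
  obtain \<delta>e where \<delta>e: "0 < \<delta>e" "path_image (curve L e) \<inter> ball p \<delta>e \<subseteq> cross_at p"
    using orthogonal_chain_cross[OF Ce(1)] Ce(2) by metis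
  have in_ends: "u \<in> e" "u' \<in> e" "w \<in> f" "w' \<in> f" using lab by auto
  obtain d1 \<epsilon>1 where g1: "d1 \<in> axes" "0 < \<epsilon>1"
      "\<And>r. 0 < r \<Longrightarrow> r < \<epsilon>1 \<Longrightarrow> p + of_real r * d1 \<in> path_image (arm L p e u)"
      "\<And>r. 0 < r \<Longrightarrow> r < \<epsilon>1 \<Longrightarrow> exit_vector (arm L p e u) r = of_real r * d1"
    using arm_germ[OF D ef(1) in_ends(1) pin(1) nve[OF in_ends(1)] Ce] by blast
  obtain d2 \<epsilon>2 where g2: "d2 \<in> axes" "0 < \<epsilon>2"
      "\<And>r. 0 < r \<Longrightarrow> r < \<epsilon>2 \<Longrightarrow> p + of_real r * d2 \<in> path_image (arm L p e u')"
      "\<And>r. 0 < r \<Longrightarrow> r < \<epsilon>2 \<Longrightarrow> exit_vector (arm L p e u') r = of_real r * d2"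
    using arm_germ[OF D ef(1) in_ends(2) pin(1) nve[OF in_ends(2)] Ce] by blast
  obtain d3 \<epsilon>3 where g3: "d3 \<in> axes" "0 < \<epsilon>3"
      "\<And>r. 0 < r \<Longrightarrow> r < \<epsilon>3 \<Longrightarrow> p + of_real r * d3 \<in> path_image (arm L p f w)"
      "\<And>r. 0 < r \<Longrightarrow> r < \<epsilon>3 \<Longrightarrow> exit_vector (arm L p f w) r = of_real r * d3"
    using arm_germ[OF D ef(2) in_ends(3) pin(2) nvf[OF in_ends(3)] Cf] by blast
  obtain d4 \<epsilon>4 where g4: "d4 \<in> axes" "0 < \<epsilon>4"
      "\<And>r. 0 < r \<Longrightarrow> r < \<epsilon>4 \<Longrightarrow> p + of_real r * d4 \<in> path_image (arm L p f w')"
      "\<And>r. 0 < r \<Longrightarrow> r < \<epsilon>4 \<Longrightarrow> exit_vector (arm L p f w') r = of_real r * d4"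
    using arm_germ[OF D ef(2) in_ends(4) pin(2) nvf[OF in_ends(4)] Cf] by blast
  have "open (- B)" "p \<in> - B" using J by auto
  then obtain \<epsilon>B where \<epsilon>B: "0 < \<epsilon>B" "ball p \<epsilon>B \<subseteq> - B" by (metis openE)
  define \<epsilon> where "\<epsilon> = Min {\<epsilon>1, \<epsilon>2, \<epsilon>3, \<epsilon>4, \<epsilon>B, \<delta>e}"
  have \<epsilon>: "0 < \<epsilon>" "\<epsilon> \<le> \<epsilon>1" "\<epsilon> \<le> \<epsilon>2" "\<epsilon> \<le> \<epsilon>3" "\<epsilon> \<le> \<epsilon>4" "\<epsilon> \<le> \<epsilon>B" "\<epsilon> \<le> \<delta>e"
    unfolding \<epsilon>_def using g1(2) g2(2) g3(2) g4(2) \<epsilon>B(1) \<delta>e(1) by simp_all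
  have dirs: "d2 = - d1 \<and> d3 = \<i> * d1 \<and> d4 = - \<i> * d1"
    by (rule ccw_axes[OF g1(1) g2(1) g3(1) g4(1) \<epsilon>(1) _ _ _ _ cc])
      (use \<epsilon> in \<open>simp_all add: g1(4) g2(4) g3(4) g4(4)\<close>)
  have dc: "d1 * cnj d1 = 1" using g1(1) by (auto simp: axes_def)
  have one: "cmod d1 = 1" using g1(1) by (auto simp: axes_def)
  define side where "side z = Im ((z - p) * cnj d1)" for z
  \<comment> \<open>Within the disc, \<open>J\<close> is exactly the diameter in direction
    \<open>d1\<close>: the two arms of \<open>e\<close> fill it, \<open>B\<close> is too far away,
    and the perpendicular rays are occupied by the arms of \<open>f\<close>, which meets
    \<open>J\<close> only in \<open>p\<close>.\<close>
  have line: "z \<in> J \<longleftrightarrow> side z = 0" if z: "z \<in> ball p \<epsilon>" for z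
  proof
    assume s: "side z = 0"
    define r where "r = Re ((z - p) * cnj d1)"
    have "(z - p) * cnj d1 = of_real r" using s by (simp add: r_def side_def complex_eq_iff)
    then have "(z - p) * (d1 * cnj d1) = of_real r * d1" by (simp add: algebra_simps)
    then have zr: "z = p + of_real r * d1" using dc by (simp add: diff_eq_eq add.commute)
    then have "\<bar>r\<bar> < \<epsilon>" using z one by (simp add: dist_norm norm_mult)
    consider "r = 0" | "0 < r" | "r < 0" by linarith
    then have "z \<in> path_image (curve L e)"
    proof cases
      case 1
      then show ?thesis using zr pin by simp
    next
      case 2
      then have "z \<in> path_image (arm L p e u)" using g1(3)[of r] zr \<open>\<bar>r\<bar> < \<epsilon>\<close> \<epsilon> by auto
      then show ?thesis using arm_props(4)[OF D ef(1) _ pin(1) nve] lab(1) by blast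
    next
      case 3
      then have "z \<in> path_image (arm L p e u')" using g2(3)[of "- r"] zr \<open>\<bar>r\<bar> < \<epsilon>\<close> \<epsilon> dirs by auto
      then show ?thesis using arm_props(4)[OF D ef(1) _ pin(1) nve] lab(1) by blast
    qed
    then show "z \<in> J" using J(1) by auto
  next
    assume zJ: "z \<in> J"
    have "z \<in> ball p \<epsilon>B" using z \<epsilon> by auto
    then have "z \<notin> B" using \<epsilon>B(2) by blast
    then have "z \<in> path_image (curve L e)" using zJ J(1) by auto
    then have "z \<in> cross_at p" using z \<epsilon> \<delta>e(2) by auto
    show "side z = 0"
    proof (rule ccontr)
      assume nz: "side z \<noteq> 0"
      define r where "r = dist p z"
      have "z \<noteq> p" using nz by (auto simp: side_def)
      then have r: "0 < r" "r < \<epsilon>" using z by (auto simp: r_def)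
      obtain d where d: "d \<in> axes" "z = p + of_real r * d"
        using axis_ray[OF \<open>z \<in> cross_at p\<close>] r_def by auto
      have "d = d3 \<or> d = d4" using d(1) g1(1) dirs nz d(2) by (auto simp: axes_def side_def)
      then have "z \<in> path_image (arm L p f w) \<or> z \<in> path_image (arm L p f w')"
        using g3(3)[of r] g4(3)[of r] r \<epsilon> d(2) by auto
      then have "z \<in> path_image (curve L f)"
        using arm_props(4)[OF D ef(2) _ pin(2) nvf] lab(2) by blast
      then show False using f(1) zJ \<open>z \<noteq> p\<close> by auto
    qed
  qed
  define H where "H = {z \<in> ball p \<epsilon>. 0 < Im ((z - p) * cnj d1)}"
  define H' where "H' = {z \<in> ball p \<epsilon>. 0 < Im ((z - p) * (- cnj d1))}"
  have conH: "connected H" "connected H'"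
    unfolding H_def H'_def by (intro convex_connected convex_halfball)+
  have HJ: "H \<inter> J = {}" "H' \<inter> J = {}" using line by (auto simp: H_def H'_def side_def)
  have ballH: "z \<in> J \<or> z \<in> H \<or> z \<in> H'" if "z \<in> ball p \<epsilon>" for z
    using line[OF that] that by (auto simp: H_def H'_def side_def)
  have half: "connected (path_image (arm L p f x) - {p})"
    "(path_image (arm L p f x) - {p}) \<inter> J = {}" "point L x \<in> path_image (arm L p f x) - {p}"
    if x: "x \<in> f" for x
  proof -
    note a = arm_props[OF D ef(2) x pin(2) nvf[OF x]]
    let ?g = "arm L p f x"
    show "connected (path_image ?g - {p})" using connected_arc_minus_start[OF a(1)] a(2) by simp
    show "(path_image ?g - {p}) \<inter> J = {}" using a(4) f(1) by auto
    show "point L x \<in> path_image ?g - {p}" using a(3) nvf[OF x] by auto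
  qed
  have hH: "p + of_real (\<epsilon>/2) * d3 \<in> H" "p + of_real (\<epsilon>/2) * d4 \<in> H'"
    using \<epsilon>(1) dirs g1(1) by (auto simp: H_def H'_def axes_def dist_norm norm_mult)
  have nep: "p + of_real (\<epsilon>/2) * d3 \<noteq> p" "p + of_real (\<epsilon>/2) * d4 \<noteq> p"
    using HJ hH pJ by auto
  have h3: "p + of_real (\<epsilon>/2) * d3 \<in> path_image (arm L p f w) - {p}"
    using g3(3)[of "\<epsilon>/2"] \<epsilon> nep by auto
  have h4: "p + of_real (\<epsilon>/2) * d4 \<in> path_image (arm L p f w') - {p}"
    using g4(3)[of "\<epsilon>/2"] \<epsilon> nep by auto
  \<comment> \<open>A half disc together with the arm that starts into it is connected and avoids
    \<open>J\<close>, so the end of that arm lies on the same side of \<open>J\<close> as the half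
    disc.\<close>
  define K where "K = H \<union> (path_image (arm L p f w) - {p})"
  define K' where "K' = H' \<union> (path_image (arm L p f w') - {p})"
  have cK: "connected K" "connected K'" unfolding K_def K'_def
    using conH half(1)[OF in_ends(3)] half(1)[OF in_ends(4)] hH h3 h4 by (auto intro!: connected_Un)
  have KJ: "K \<inter> J = {}" "K' \<inter> J = {}" unfolding K_def K'_def
    using HJ half(2)[OF in_ends(3)] half(2)[OF in_ends(4)] by auto
  have inK: "point L w \<in> K" "point L w' \<in> K'"
    using half(3) in_ends by (auto simp: K_def K'_def)
  have "\<not> (point L w \<in> outside J \<and> point L w' \<in> outside J)"
  proof
    assume "point L w \<in> outside J \<and> point L w' \<in> outside J"
    then have "H \<subseteq> outside J" "H' \<subseteq> outside J"
      using same_side(2)[OF cK(1) KJ(1) inK(1)] same_side(2)[OF cK(2) KJ(2) inK(2)]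
      by (auto simp: K_def K'_def)
    then have "ball p \<epsilon> \<inter> inside J = {}" 
      using ballH inside_Int_outside[of J] inside_no_overlap[of J] by blast
    moreover have "p \<in> closure (inside J)" using fr(1) by (simp add: frontier_def)
    ultimately show False using \<epsilon>(1)
      by (metis closure_iff_nhds_not_empty centre_in_ball inf_commute open_ball order_refl)
  qed
  moreover have "point L w \<in> inside J \<union> outside J" "point L w' \<in> inside J \<union> outside J"
    using inK KJ inside_Un_outside[of J] by blast+
  moreover have "{v, v'} = {w, w'}" using f lab by simp
  moreover have "point L v \<notin> inside J" using v inside_Int_outside[of J] by blast
  ultimately show ?thesis using v by (auto simp: doubleton_eq_iff simp del: inside_Un_outside)
qed

section \<open>Triangles in orthogonal layouts\<close>

lemma edge_images_inter:
  assumes G: "simple_graph G" and D: "is_drawing G D"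
    and e: "e \<in> edges G" "f \<in> edges G" "e \<noteq> f" "\<And>p. \<not> meet_at G D e f p"
  shows "path_image (curve D e) \<inter> path_image (curve D f) \<subseteq> point D ` (e \<inter> f)"
proof
  fix p assume p: "p \<in> path_image (curve D e) \<inter> path_image (curve D f)"
  with e have "p \<in> point D ` verts G" by (auto simp: meet_at_def)
  then obtain v where v: "v \<in> verts G" "p = point D v" by auto
  then have "v \<in> e" "v \<in> f" using D e p by (auto simp: is_drawing_def)
  then show "p \<in> point D ` (e \<inter> f)" using v by auto
qed

locale drawn_triangle =
  fixes G :: "'v graph" and L :: "'v drawing" and a b c :: 'v
  assumes G: "simple_graph G" and L: "is_drawing G L"
    and ab: "{a, b} \<in> edges G" and bc: "{b, c} \<in> edges G" and ca: "{c, a} \<in> edges G"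
begin

definition J :: "complex set" where
  "J = path_image (curve L {a, b}) \<union> path_image (curve L {b, c}) \<union> path_image (curve L {c, a})"

lemma distinct: "a \<noteq> b" "b \<noteq> c" "c \<noteq> a"
  using edge_ends_distinct[OF L] ab bc ca by auto

lemma no_meet_adjacent: "e \<inter> f \<noteq> {} \<Longrightarrow> \<not> meet_at G L e f p"
  using L unfolding is_drawing_def by blast

lemma sides_inter:
  "path_image (curve L {a, b}) \<inter> path_image (curve L {b, c}) \<subseteq> {point L b}"
  "path_image (curve L {b, c}) \<inter> path_image (curve L {c, a}) \<subseteq> {point L c}"
  "path_image (curve L {a, b}) \<inter> path_image (curve L {c, a}) \<subseteq> {point L a}"
proof -
  have I: "{a, b} \<inter> {b, c} = {b}" "{b, c} \<inter> {c, a} = {c}" "{a, b} \<inter> {c, a} = {a}"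
    using distinct by auto
  have ne: "{a, b} \<noteq> {b, c}" "{b, c} \<noteq> {c, a}" "{a, b} \<noteq> {c, a}"
    using distinct by (auto simp: doubleton_eq_iff)
  show "path_image (curve L {a, b}) \<inter> path_image (curve L {b, c}) \<subseteq> {point L b}"
    using edge_images_inter[OF G L ab bc ne(1)] no_meet_adjacent[of "{a, b}" "{b, c}"] by (auto simp: I)
  show "path_image (curve L {b, c}) \<inter> path_image (curve L {c, a}) \<subseteq> {point L c}"
    using edge_images_inter[OF G L bc ca ne(2)] no_meet_adjacent[of "{b, c}" "{c, a}"] by (auto simp: I)
  show "path_image (curve L {a, b}) \<inter> path_image (curve L {c, a}) \<subseteq> {point L a}"
    using edge_images_inter[OF G L ab ca ne(3)] no_meet_adjacent[of "{a, b}" "{c, a}"] by (auto simp: I)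
qed

text \<open>Adjacent edges share only their common end, so in every drawing the three sides form a
  simple closed curve, whatever else crosses them, and the Jordan curve theorem applies.\<close>

lemma J_Jordan:
  "open (inside J)" "open (outside J)" "frontier (inside J) = J" "frontier (outside J) = J"
  "compact J"
proof -
  let ?ab = "curve_from L a {a, b}" and ?bc = "curve_from L b {b, c}" and ?ca = "curve_from L c {c, a}"
  note p1 = curve_from_props[OF L ab insertI1] and p2 = curve_from_props[OF L bc insertI1]
    and p3 = curve_from_props[OF L ca insertI1]
  note f1 = pathfinish_curve_from[OF L ab] and f2 = pathfinish_curve_from[OF L bc]
    and f3 = pathfinish_curve_from[OF L ca]
  have s: "simple_path (?ab +++ ?bc +++ ?ca)"
    by (rule simple_path_join3I) (use p1 p2 p3 f1 f2 f3 sides_inter in auto)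
  have l: "pathfinish (?ab +++ ?bc +++ ?ca) = pathstart (?ab +++ ?bc +++ ?ca)"
    by (simp add: p1 f3)
  have i: "path_image (?ab +++ ?bc +++ ?ca) = J"
    by (simp add: path_image_join J_def p1 p2 p3 f1 f2 f3 Un_assoc)
  show "open (inside J)" "open (outside J)" "frontier (inside J) = J" "frontier (outside J) = J"
    using Jordan_inside_outside[OF s l] unfolding i by auto
  show "compact J" using compact_simple_path_image[OF s] by (simp add: i)
qed

text \<open>A horizontal or vertical line supporting the triangle touches it away from its corners,
  whose four ports are all used by edges inside. Four such lines share three sides.\<close>

lemma long_side:
  assumes C: "orthogonal_layout G L C"
    and deg: "\<And>x. x \<in> {a, b, c} \<Longrightarrow> card (incident_edges G x) = 4"
    and inner: "\<And>x e. x \<in> {a, b, c} \<Longrightarrow> e \<in> incident_edges G x \<Longrightarrow>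
      path_image (curve L e) \<subseteq> J \<union> inside J"
  shows "\<exists>e\<in>{{a, b}, {b, c}, {c, a}}. 4 \<le> complexity C e"
proof -
  let ?E = "{{a, b}, {b, c}, {c, a}}"
  have chain: "orthogonal_chain (C e)" "curve L e = polyline (C e)" if "e \<in> edges G" for e
    using C that by (auto simp: orthogonal_layout_def)
  have E: "?E \<subseteq> edges G" using ab bc ca by auto
  have J_eq: "J = (\<Union>e\<in>?E. path_image (polyline (C e)))"
    using chain(2) ab bc ca by (auto simp: J_def)
  have "J \<noteq> {}" using point_on_edge[OF L ab] by (auto simp: J_def)
  have "\<exists>z\<in>J. \<forall>w\<in>J. height d w \<le> height d z" for d
    by (intro continuous_attains_sup J_Jordan \<open>J \<noteq> {}\<close>) (auto simp: height_def intro!: continuous_intros)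
  then obtain top where top: "\<And>d. top d \<in> J" "\<And>d w. w \<in> J \<Longrightarrow> height d w \<le> height d (top d)"
    by metis
  define M where "M d = height d (top d)" for d
  \<comment> \<open>A convex set containing \<open>J\<close> has its whole complement outside
    \<open>J\<close>. Hence a half plane that supports the triangle also contains everything
    enclosed by it, and the bound extends to the inner edges.\<close>
  have le: "height d w \<le> M d" if "w \<in> J \<union> inside J" for d w
  proof -
    have "height d = (\<lambda>z. Complex (Re d) (Im d) \<bullet> z)"
      by (auto simp: height_def inner_complex_def)
    then have "convex {z. height d z \<le> M d}" by (simp add: convex_halfspace_le)
    then have "- {z. height d z \<le> M d} \<subseteq> outside J"
      using top(2) by (intro outside_subset_convex) (auto simp: M_def)
    moreover have "w \<notin> outside J" using that union_with_inside by blast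
    ultimately show ?thesis by auto
  qed
  have corner: "height d (point L x) < M d" if x: "x \<in> {a, b, c}" and d: "d \<in> axes" for x d
  proof (rule port_height[where I = "incident_edges G x" and C = C])
    show "card (incident_edges G x) = 4" by (rule deg[OF x])
    obtain e where e: "e \<in> ?E" "x \<in> e" using x by auto
    then have "e \<in> edges G" using E by blast
    then have "e \<subseteq> verts G" using G by (simp add: simple_graph_def)
    with e(2) have "x \<in> verts G" by blast
    then show "inj_on (\<lambda>e. port (C e) (point L x)) (incident_edges G x)"
      using C by (simp add: orthogonal_layout_def)
  next
    fix e assume e: "e \<in> incident_edges G x"
    then have ee: "e \<in> edges G" "x \<in> e" by (auto simp: incident_edges_def)
    have "C e \<noteq> []" using chain(1)[OF ee(1)] by (auto simp: orthogonal_chain_def)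
    then have "{pathstart (curve L e), pathfinish (curve L e)} = {hd (C e), last (C e)}"
      by (simp add: chain(2)[OF ee(1)] polyline_ends)
    moreover have "{pathstart (curve L e), pathfinish (curve L e)} = point L ` e"
      using L ee by (auto simp: is_drawing_def)
    ultimately have "point L x \<in> {hd (C e), last (C e)}" using ee(2) by (metis imageI)
    then show "orthogonal_chain (C e) \<and> (hd (C e) = point L x \<or> last (C e) = point L x)"
      using chain(1)[OF ee(1)] by auto
    fix z assume "z \<in> path_image (polyline (C e))"
    then show "height d z \<le> M d" using inner[OF x e] chain(2)[OF ee(1)] le by auto
  qed (rule d)
  have "\<exists>e\<in>?E. 5 \<le> length (C e)"
  proof (rule long_chain)
    show "finite ?E" "card ?E \<le> 3" by (simp_all add: card_insert_if)
  next
    fix e assume e: "e \<in> ?E"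
    then have eG: "e \<in> edges G" using E by blast
    show "orthogonal_chain (C e)" by (rule chain(1)[OF eG])
    show "height d z \<le> M d" if "z \<in> path_image (polyline (C e))" for d z
    proof -
      have "z \<in> J" unfolding J_eq using e that by (rule UN_I)
      then show ?thesis by (intro le UnI1)
    qed
    fix d assume d: "d \<in> axes"
    have "C e \<noteq> []" using chain(1)[OF eG] by (auto simp: orthogonal_chain_def)
    then have "{hd (C e), last (C e)} = {pathstart (curve L e), pathfinish (curve L e)}"
      by (simp add: chain(2)[OF eG] polyline_ends)
    also have "\<dots> = point L ` e" using L eG by (auto simp: is_drawing_def)
    also have "\<dots> \<subseteq> point L ` {a, b, c}" using e by auto
    finally obtain x y where "x \<in> {a, b, c}" "y \<in> {a, b, c}" "hd (C e) = point L x" "last (C e) = point L y"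
      unfolding insert_subset by (elim conjE imageE)
    then show "height d (hd (C e)) < M d \<and> height d (last (C e)) < M d"
      using corner[OF _ d] by metis
  next
    fix d :: complex
    show "\<exists>e\<in>?E. \<exists>z\<in>path_image (polyline (C e)). height d z = M d"
    proof -
      obtain e where "e \<in> ?E" "top d \<in> path_image (polyline (C e))"
        using top(1)[of d] unfolding J_eq by (rule UN_E)
      then show ?thesis unfolding M_def by blast
    qed
  qed
  then show ?thesis by (auto simp: complexity_def)
qed

text \<open>Without the end \<open>x\<close> the edge is still connected, and it misses all three
  sides: it crosses none of them, and \<open>x\<close> is the only vertex it can share with them. So
  all of it stays on the side of \<open>y\<close>.\<close>

lemma edge_to_inside:
  assumes x: "x \<in> {a, b, c}" and e: "{x, y} \<in> edges G" and y: "point L y \<in> inside J"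
    and nm: "\<And>f p. f \<in> {{a, b}, {b, c}, {c, a}} \<Longrightarrow> \<not> meet_at G L {x, y} f p"
  shows "path_image (curve L {x, y}) \<subseteq> J \<union> inside J"
proof -
  let ?P = "path_image (curve L {x, y})"
  have xJ: "point L z \<in> J" if "z \<in> {a, b, c}" for z
    using that point_on_edge[OF L ab] point_on_edge[OF L bc] by (auto simp: J_def)
  then have yn: "y \<notin> {a, b, c}" using y inside_no_overlap[of J] by blast
  have "?P \<inter> path_image (curve L f) \<subseteq> {point L x}" if f: "f \<in> {{a, b}, {b, c}, {c, a}}" for f
  proof -
    have "f \<in> edges G" using f ab bc ca by auto
    moreover have "{x, y} \<noteq> f" "{x, y} \<inter> f \<subseteq> {x}" using f yn by auto
    ultimately show ?thesis using edge_images_inter[OF G L e _ _ nm[OF f]] by blast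
  qed
  then have "(?P - {point L x}) \<inter> J = {}" unfolding J_def by blast
  moreover have "connected (?P - {point L x})" by (rule connected_edge_minus_end[OF L e]) simp
  moreover have "point L y \<in> ?P - {point L x}"
    using point_on_edge[OF L e, of y] edge_ends_distinct(2)[OF L e] by auto
  ultimately have "z \<in> inside J" if "z \<in> ?P - {point L x}" for z
    using same_side(1) that y by metis
  then show ?thesis using xJ[OF x] by auto
qed

text \<open>In a 1-planar drawing the connecting edge has no crossing other than \<open>p\<close>,
  so it meets the triangle there and nowhere else. The two remaining sides form a closed set that
  misses \<open>p\<close>, which reduces the claim to a crossing of two edges.\<close>

lemma connector_end_inside:
  assumes P: "one_planar_drawing G L" and C: "orthogonal_layout G L C"
    and e: "e \<in> {{a, b}, {b, c}, {c, a}}" and m: "meet_at G L e {v, v'} p"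
    and v: "point L v \<in> outside J" and v': "v' \<notin> {a, b, c}"
  shows "point L v' \<in> inside J"
proof -
  let ?E = "{{a, b}, {b, c}, {c, a}}"
  have chain: "orthogonal_chain (C e)" "curve L e = polyline (C e)" if "e \<in> edges G" for e
    using C that by (auto simp: orthogonal_layout_def)
  have eG: "e \<in> edges G" "{v, v'} \<in> edges G" "e \<noteq> {v, v'}" using m by (auto simp: meet_at_def)
  have m': "meet_at G L {v, v'} e p" using m by (auto simp: meet_at_def)
  have uniq: "f = e \<and> q = p" if "meet_at G L {v, v'} f q" for f q
    using P m' that unfolding one_planar_drawing_def by blast
  have EG: "?E \<subseteq> edges G" using ab bc ca by auto
  have closed: "closed (path_image (curve L f))" if "f \<in> edges G" for f
    using L that by (auto simp: is_drawing_def intro: closed_arc_image)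
  have pv: "p \<notin> point L ` verts G" using m by (auto simp: meet_at_def)
  have sub: "f \<subseteq> verts G" if "f \<in> edges G" for f using G that by (auto simp: simple_graph_def)
  have disj: "e \<inter> {v, v'} = {}" using m L unfolding is_drawing_def by blast
  have "point L z \<in> J" if "z \<in> {a, b, c}" for z
    using that point_on_edge[OF L ab] point_on_edge[OF L bc] by (auto simp: J_def)
  then have vn: "v \<notin> {a, b, c}" using v outside_no_overlap[of J] by blast
  let ?B = "\<Union>f\<in>?E - {e}. path_image (curve L f)"
  have pe: "p \<in> path_image (curve L e)" using m by (auto simp: meet_at_def)
  have adj: "\<not> meet_at G L e f q" if "f \<in> ?E" for f q
    by (rule no_meet_adjacent) (use e that in auto)
  have pB: "p \<notin> ?B"
  proof
    assume "p \<in> ?B"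
    then obtain f where f: "f \<in> ?E" "f \<noteq> e" "p \<in> path_image (curve L f)" by blast
    have "p \<in> point L ` (e \<inter> f)"
      using edge_images_inter[OF G L eG(1) _ f(2)[symmetric] adj[OF f(1)]] f EG pe by blast
    then show False using pv sub[OF eG(1)] by blast
  qed
  have "J = (\<Union>f\<in>insert e (?E - {e}). path_image (curve L f))"
    unfolding insert_Diff[OF e] by (simp add: J_def Un_assoc)
  then have JB: "J = path_image (curve L e) \<union> ?B" by (simp only: UN_insert)
  have cB: "closed ?B" by (intro closed_UN ballI closed) (use EG in auto)
  have "path_image (curve L {v, v'}) \<inter> path_image (curve L f) \<subseteq> {p}" if f: "f \<in> ?E" for f
  proof
    fix q assume q: "q \<in> path_image (curve L {v, v'}) \<inter> path_image (curve L f)"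
    have fG: "f \<in> edges G" using f EG by blast
    show "q \<in> {p}"
    proof (cases "q \<in> point L ` verts G")
      case True
      then obtain x where x: "x \<in> verts G" "q = point L x" by auto
      then have "x \<in> {v, v'}" "x \<in> f" using L q eG fG unfolding is_drawing_def by blast+
      then show ?thesis using f vn v' by auto
    next
      case False
      have "f \<noteq> {v, v'}" using f vn v' by auto
      then have "meet_at G L {v, v'} f q" using q False fG eG by (auto simp: meet_at_def)
      then show ?thesis using uniq by simp
    qed
  qed
  then have "path_image (curve L {v, v'}) \<inter> J \<subseteq> {p}" unfolding J_def by blast
  then show ?thesis
    using crossing_separates[OF G L m chain[OF eG(1)] chain[OF eG(2)] JB cB pB _ _ _ refl v]
      J_Jordan(3,4) pe JB by blast
qed

end

section \<open>The ring of gadgets\<close>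

text \<open>In gadget \<open>i\<close>, vertex \<open>6 i + x\<close> has the following role: \<open>2, 3, 4\<close> form the triangle, \<open>1\<close> and
  \<open>5\<close> lie inside it, and \<open>0\<close> and \<open>6\<close> are shared with the neighbouring gadgets. The edges \<open>0 1\<close> and
  \<open>5 6\<close> cross the triangle. Two further vertices close the ring.\<close>

definition gadget_edges :: "(nat \<times> nat) set" where
  "gadget_edges = {(0, 1), (1, 2), (2, 3), (3, 4), (4, 5), (5, 6), (1, 3), (1, 4), (2, 5), (3, 5), (2, 4)}"

definition ring :: "nat \<Rightarrow> nat graph" where
  "ring m = \<lparr>verts = {..6 * m + 2},
     edges = (\<lambda>(i, x, y). {6 * i + x, 6 * i + y}) ` ({..<m} \<times> gadget_edges) \<union>
       {{6 * m, 6 * m + 1}, {6 * m + 1, 6 * m + 2}, {0, 6 * m + 2}}\<rparr>"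

lemma verts_ring [simp]: "verts (ring m) = {..6 * m + 2}"
  by (simp add: ring_def)

lemma gadget_edges_bounds: "(x, y) \<in> gadget_edges \<Longrightarrow> x < y \<and> y \<le> 6"
  by (auto simp: gadget_edges_def)

lemma ring_edge_cases:
  assumes "e \<in> edges (ring m)"
  obtains i x y where "i < m" "(x, y) \<in> gadget_edges" "e = {6 * i + x, 6 * i + y}"
  | "e = {6 * m, 6 * m + 1}" | "e = {6 * m + 1, 6 * m + 2}" | "e = {0, 6 * m + 2}"
proof -
  from assms consider "e \<in> (\<lambda>(i, x, y). {6 * i + x, 6 * i + y}) ` ({..<m} \<times> gadget_edges)"
    | "e = {6 * m, 6 * m + 1}" | "e = {6 * m + 1, 6 * m + 2}" | "e = {0, 6 * m + 2}"
    unfolding ring_def graph.simps Un_iff insert_iff empty_iff by metis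
  then show thesis
  proof cases
    case 1
    then obtain i x y where "i < m" "(x, y) \<in> gadget_edges" "e = {6 * i + x, 6 * i + y}" by auto
    then show thesis by (rule that(1))
  qed (use that in auto)
qed

lemma gadget_edge:
  "i < m \<Longrightarrow> (x, y) \<in> gadget_edges \<Longrightarrow> {6 * i + x, 6 * i + y} \<in> edges (ring m)"
  unfolding ring_def graph.simps by (intro UnI1 image_eqI[of _ _ "(i, x, y)"]) auto

lemma outer_edges:
  "{6 * m, 6 * m + 1} \<in> edges (ring m)" "{6 * m + 1, 6 * m + 2} \<in> edges (ring m)"
  "{0, 6 * m + 2} \<in> edges (ring m)"
  by (auto simp: ring_def)

section \<open>Simplicity and degrees of the ring\<close>

lemma simple_graph_ring: "simple_graph (ring m)"
  unfolding simple_graph_def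
proof (intro conjI ballI)
  fix e assume "e \<in> edges (ring m)"
  then have "e \<subseteq> verts (ring m) \<and> card e = 2"
    by (cases rule: ring_edge_cases) (use gadget_edges_bounds in fastforce)+
  then show "e \<subseteq> verts (ring m)" "card e = 2" by auto
qed simp

lemma finite_edges_ring: "finite (edges (ring m))"
  by (simp add: ring_def gadget_edges_def)

text \<open>Offsets 1 to 5 occur in one gadget only, whereas 0 and 6 name vertices shared with a
  neighbour. One offset strictly between 0 and 6 therefore suffices to identify the gadget.\<close>

lemma gadget_index:
  fixes i j r x :: nat
  assumes "6 * j + r = 6 * i + x" "x \<le> 6" "1 \<le> r" "r \<le> 5"
  shows "i = j" "x = r"
proof -
  have "\<not> i < j" "\<not> j < i" using assms by linarith+
  then show "i = j" "x = r" using assms(1) by auto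
qed

lemma incident_edges_gadget:
  assumes "j < m" "1 \<le> r" "r \<le> 5"
  shows "incident_edges (ring m) (6 * j + r) =
    (\<lambda>s. {6 * j + r, 6 * j + s}) ` {s. (r, s) \<in> gadget_edges \<or> (s, r) \<in> gadget_edges}"
    (is "?I = ?f ` ?N")
proof
  show "?I \<subseteq> ?f ` ?N"
  proof
    fix e assume "e \<in> ?I"
    then have e: "e \<in> edges (ring m)" "6 * j + r \<in> e" by (auto simp: incident_edges_def)
    from e(1) show "e \<in> ?f ` ?N"
    proof (cases rule: ring_edge_cases)
      case (1 i x y)
      then have "x \<le> 6" "y \<le> 6" using gadget_edges_bounds by fastforce+
      then have "i = j" "r = x \<or> r = y" using gadget_index[of j r i] assms e(2) 1(3) by auto
      then show ?thesis using 1 by (auto simp: insert_commute)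
    qed (use assms e(2) in auto)
  qed
  show "?f ` ?N \<subseteq> ?I"
    using gadget_edge[OF assms(1)] by (fastforce simp: incident_edges_def insert_commute)
qed

lemma gadget_degree:
  assumes "j < m" "1 \<le> r" "r \<le> 5"
  shows "card (incident_edges (ring m) (6 * j + r)) = 4"
proof -
  have "inj_on (\<lambda>s. {6 * j + r, 6 * j + s}) {s. (r, s) \<in> gadget_edges \<or> (s, r) \<in> gadget_edges}"
    by (auto simp: inj_on_def doubleton_eq_iff)
  moreover have "card {s. (r, s) \<in> gadget_edges \<or> (s, r) \<in> gadget_edges} = 4"
  proof -
    have "{s. (1, s) \<in> gadget_edges \<or> (s, 1) \<in> gadget_edges} = {0, 2, 3, 4}"
      "{s. (2, s) \<in> gadget_edges \<or> (s, 2) \<in> gadget_edges} = {1, 3, 4, 5}"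
      "{s. (3, s) \<in> gadget_edges \<or> (s, 3) \<in> gadget_edges} = {1, 2, 4, 5}"
      "{s. (4, s) \<in> gadget_edges \<or> (s, 4) \<in> gadget_edges} = {1, 2, 3, 5}"
      "{s. (5, s) \<in> gadget_edges \<or> (s, 5) \<in> gadget_edges} = {2, 3, 4, 6}"
      by (auto simp: gadget_edges_def)
    moreover have "r = 1 \<or> r = 2 \<or> r = 3 \<or> r = 4 \<or> r = 5" using assms(2,3) by linarith
    ultimately show ?thesis by (elim disjE) simp_all
  qed
  ultimately show ?thesis unfolding incident_edges_gadget[OF assms] by (simp add: card_image)
qed

lemma max_degree_ring: "max_degree_le 4 (ring m)"
  unfolding max_degree_le_def
proof
  fix v assume v: "v \<in> verts (ring m)"
  show "card (incident_edges (ring m) v) \<le> 4"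
  proof (cases "v < 6 * m \<and> v mod 6 \<noteq> 0")
    case True
    then have "v div 6 < m" "1 \<le> v mod 6" "v mod 6 \<le> 5" by linarith+
    then show ?thesis using gadget_degree[of "v div 6" m "v mod 6"] by simp
  next
    case False
    \<comment> \<open>Shared and closing vertices have all their neighbours in this list. Truncated
      subtraction at \<open>v = 0\<close> is harmless, since only an upper bound on the degree is
      wanted.\<close>
    let ?N = "{v + 1, v - 1, 0, 6 * m + 2}"
    have "incident_edges (ring m) v \<subseteq> (\<lambda>w. {v, w}) ` ?N"
    proof
      fix e assume "e \<in> incident_edges (ring m) v"
      then have e: "e \<in> edges (ring m)" "v \<in> e" by (auto simp: incident_edges_def)
      from e(1) show "e \<in> (\<lambda>w. {v, w}) ` ?N"
      proof (cases rule: ring_edge_cases)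
        case (1 i x y)
        have xy: "x \<le> 6" "y \<le> 6" using 1(2) gadget_edges_bounds by fastforce+
        have z: "z = 0 \<or> z = 6" if "v = 6 * i + z" "z \<le> 6" for z
        proof (rule ccontr)
          assume "\<not> ?thesis"
          then have "z < 6" "z \<noteq> 0" using that by auto
          then have "v mod 6 = z" using that by simp
          moreover have "v < 6 * m" using that 1(1) \<open>z < 6\<close> by linarith
          ultimately show False using False \<open>z \<noteq> 0\<close> by simp
        qed
        have "v = 6 * i + x \<or> v = 6 * i + y" using e(2) 1(3) by auto
        then show ?thesis
        proof
          assume "v = 6 * i + x"
          moreover from this have "x = 0" using z[of x] xy 1(2) by (auto simp: gadget_edges_def)
          moreover from this have "y = 1" using 1(2) by (auto simp: gadget_edges_def)
          ultimately have "e = {v, v + 1}" using 1(3) by auto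
          then show ?thesis by blast
        next
          assume "v = 6 * i + y"
          moreover from this have "y = 6" using z[of y] xy 1(2) by (auto simp: gadget_edges_def)
          moreover from this have "x = 5" using 1(2) by (auto simp: gadget_edges_def)
          ultimately have "e = {v, v - 1}" using 1(3) by auto
          then show ?thesis by blast
        qed
      qed (use e(2) in \<open>auto simp: insert_commute\<close>)
    qed
    then have "card (incident_edges (ring m) v) \<le> card ((\<lambda>w. {v, w}) ` ?N)"
      by (intro card_mono) auto
    also have "\<dots> \<le> card ?N" by (rule card_image_le) simp
    also have "\<dots> \<le> 4" by (simp add: card_insert_if)
    finally show ?thesis .
  qed
qed

section \<open>Biconnectivity from a Hamiltonian cycle\<close>

lemma ring_cycle:
  assumes "k < 6 * m + 2"
  shows "{k, Suc k} \<in> edges (ring m)"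
proof (cases "k < 6 * m")
  case True
  then have "k div 6 < m" by linarith
  \<comment> \<open>Consecutive offsets are adjacent, so each gadget has a path through all its
    vertices from 0 to 6, and these paths join at the shared vertices.\<close>
  moreover have "(k mod 6, Suc (k mod 6)) \<in> gadget_edges"
  proof -
    have "k mod 6 \<in> {0, 1, 2, 3, 4, 5}" by auto
    then show ?thesis by (auto simp: gadget_edges_def)
  qed
  ultimately have "{6 * (k div 6) + k mod 6, 6 * (k div 6) + Suc (k mod 6)} \<in> edges (ring m)"
    by (rule gadget_edge)
  then show ?thesis by simp
next
  case False
  then have "k = 6 * m \<or> k = 6 * m + 1" using assms by auto
  then show ?thesis using outer_edges(1,2)[of m] by auto
qed

text \<open>A cycle without one vertex is a path. All vertices are linked to the hub
  \<open>n\<close>: those above the deleted \<open>v\<close> by climbing, those below by descending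
  to 0 and taking the closing edge. If \<open>n\<close> itself is deleted, 0 is the hub.\<close>

lemma Hamiltonian_cycle_biconnected:
  fixes G :: "nat graph"
  assumes V: "verts G = {..n}" and n: "2 \<le> n"
    and step: "\<And>k. k < n \<Longrightarrow> {k, Suc k} \<in> edges G" and last: "{0, n} \<in> edges G"
  shows "biconnected G"
proof -
  have path: "(i, j) \<in> {(x, y). {x, y} \<in> E}\<^sup>*" if "i \<le> j" "\<And>k. i \<le> k \<Longrightarrow> k < j \<Longrightarrow> {k, Suc k} \<in> E"
    for i j :: nat and E
    using that(1)
  proof (induction rule: inc_induct)
    case (step k)
    then show ?case using that(2)[of k] by (intro converse_rtrancl_into_rtrancl[of k "Suc k"]) auto
  qed simp
  have symm: "sym ({(x, y). {x, y} \<in> E}\<^sup>*)" for E :: "nat set set"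
    by (rule sym_rtrancl) (auto simp: sym_def insert_commute)
  have hub: "connected_graph H" if "h \<in> verts H" "\<And>u. u \<in> verts H \<Longrightarrow> (u, h) \<in> {(x, y). {x, y} \<in> edges H}\<^sup>*"
    for H :: "nat graph" and h
    unfolding connected_graph_def
    using that symm[of "edges H"] by (auto simp: sym_def intro: rtrancl_trans)
  have "connected_graph G"
    by (rule hub[of n]) (auto simp: V intro!: path step)
  moreover have "connected_graph (delete_vertex G v)" if v: "v \<le> n" for v
  proof (cases "v = n")
    case True
    show ?thesis
    proof (rule hub[of 0])
      fix u assume "u \<in> verts (delete_vertex G v)"
      then have "u < n" using True by (auto simp: V delete_vertex_def)
      then have "(0, u) \<in> {(x, y). {x, y} \<in> edges (delete_vertex G v)}\<^sup>*"
        using True by (intro path) (auto simp: delete_vertex_def step)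
      then show "(u, 0) \<in> {(x, y). {x, y} \<in> edges (delete_vertex G v)}\<^sup>*"
        using symm by (auto simp: sym_def)
    qed (use True n in \<open>auto simp: V delete_vertex_def\<close>)
  next
    case False
    show ?thesis
    proof (rule hub[of n])
      fix u assume "u \<in> verts (delete_vertex G v)"
      then have u: "u \<le> n" "u \<noteq> v" by (auto simp: V delete_vertex_def)
      show "(u, n) \<in> {(x, y). {x, y} \<in> edges (delete_vertex G v)}\<^sup>*"
      proof (cases "v < u")
        case True
        then show ?thesis using u by (intro path) (auto simp: delete_vertex_def step)
      next
        case f: False
        then have "(0, u) \<in> {(x, y). {x, y} \<in> edges (delete_vertex G v)}\<^sup>*"
          using u v by (intro path) (auto simp: delete_vertex_def step)
        then have "(u, 0) \<in> {(x, y). {x, y} \<in> edges (delete_vertex G v)}\<^sup>*"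
          using symm by (auto simp: sym_def)
        moreover have "{0, n} \<in> edges (delete_vertex G v)"
          using last False f u by (auto simp: delete_vertex_def)
        ultimately show ?thesis by (auto intro: rtrancl_into_rtrancl)
      qed
    qed (use False in \<open>auto simp: V delete_vertex_def\<close>)
  qed
  ultimately show ?thesis using n by (auto simp: biconnected_def V)
qed

lemma biconnected_ring: "biconnected (ring m)"
  by (rule Hamiltonian_cycle_biconnected[of _ "6 * m + 2"]) (use outer_edges(3)[of m] in \<open>auto simp: ring_cycle\<close>)

section \<open>A straight-line drawing of the ring\<close>

lemma arm_linepath_exit:
  assumes g: "curve_from D u e = linepath a b" and ab: "a \<noteq> b"
    and t: "0 < t" "t < 1" "p = linepath a b t"
    and r: "0 < r" "r < dist p a"
  shows "exit_vector (arm D p e u) r = of_real (r / cmod (a - b)) * (a - b)"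
proof -
  have "inj_on (linepath a b) {0..1}" using ab arc_linepath arc_def by blast
  then have inv: "inv_into {0..1} (linepath a b) p = t" using t by (intro inv_into_f_eq) auto
  define h where "h = arm D p e u"
  have h: "h = subpath t 0 (linepath a b)" by (simp add: h_def arm_def g inv)
  have pa: "a - p = of_real t * (a - b)"
    by (simp add: t(3) linepath_def scaleR_conv_of_real algebra_simps)
  have hs: "h s = p + of_real s * (a - p)" for s
    by (simp add: h subpath_def t(3) linepath_def scaleR_conv_of_real algebra_simps)
  have d: "dist p (h s) = \<bar>s\<bar> * dist p a" for s
    by (simp add: hs dist_norm norm_mult norm_minus_commute)
  have da: "dist p a = t * cmod (a - b)" using pa t(1) by (metis dist_commute dist_norm norm_mult norm_of_real abs_of_pos)
  have "0 < cmod (a - b)" using ab by simp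
  have pos: "0 < dist p a" using da t(1) \<open>0 < cmod (a - b)\<close> by simp
  show ?thesis unfolding h_def[symmetric]
  proof (rule exit_vector_eqI)
    show "path h" unfolding h using t by (intro path_subpath) auto
    show "h 0 = p" by (simp add: hs)
    show "\<exists>s\<in>{0..1}. dist p (h s) = r"
      using r pos by (intro bexI[of _ "r / dist p a"]) (auto simp: d)
    fix s :: real assume s: "s \<in> {0..1}" "dist p (h s) = r"
    then have "s = r / dist p a" using pos by (auto simp: d field_simps)
    then have "of_real s * (a - p) = of_real (r / cmod (a - b)) * (a - b)"
      using t(1) by (simp add: pa da)
    then show "h s = p + of_real (r / cmod (a - b)) * (a - b)" by (simp add: hs)
  qed (rule r)
qed

text \<open>Positive factors do not change \<open>Arg2pi\<close>. Since \<open>c\<close> is opposite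
  to \<open>a\<close>, its angle is \<open>pi\<close>, and \<open>b\<close> comes before it exactly
  when it points to the left of \<open>a\<close>.\<close>

lemma ccw_scaled:
  assumes "0 < \<rho>" "0 < A" "0 < B" "0 < C" "0 < Im (b / a)" "c = - a"
    and "\<And>r. 0 < r \<Longrightarrow> r < \<rho> \<Longrightarrow> exit_vector g1 r = of_real (r / A) * a"
    and "\<And>r. 0 < r \<Longrightarrow> r < \<rho> \<Longrightarrow> exit_vector g2 r = of_real (r / B) * b"
    and "\<And>r. 0 < r \<Longrightarrow> r < \<rho> \<Longrightarrow> exit_vector g3 r = of_real (r / C) * c"
  shows "ccw g1 g2 g3"
proof -
  have a: "a \<noteq> 0" using assms(5) by auto
  have "\<forall>\<^sub>F r in at_right 0. 0 < r \<and> r < \<rho>"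
    using eventually_at_right_real[OF assms(1)] by (rule eventually_mono) auto
  then show ?thesis unfolding ccw_def
  proof (rule eventually_mono)
    fix r :: real assume r: "0 < r \<and> r < \<rho>"
    have "exit_vector g2 r / exit_vector g1 r = of_real (A / B) * (b / a)"
      using r assms by simp
    then have "Arg2pi (exit_vector g2 r / exit_vector g1 r) = Arg2pi (b / a)"
      using assms by (metis Arg2pi_times_of_real divide_pos_pos)
    moreover have "exit_vector g3 r / exit_vector g1 r = of_real (- (A / C))"
      using r assms a by simp
    then have "Arg2pi (exit_vector g3 r / exit_vector g1 r) = pi"
      using assms by (simp only: Arg2pi_of_real) simp
    moreover have "0 < Arg2pi (b / a) \<and> Arg2pi (b / a) < pi" using assms(5) Arg2pi_lt_pi by blast
    ultimately show "0 < Arg2pi (exit_vector g2 r / exit_vector g1 r) \<and>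
        Arg2pi (exit_vector g2 r / exit_vector g1 r) < Arg2pi (exit_vector g3 r / exit_vector g1 r)"
      by simp
  qed
qed

text \<open>The two arms of a straight edge point in opposite directions, so a half turn maps the
  arms towards \<open>u\<close>, \<open>v\<close> to those towards \<open>u'\<close>,
  \<open>v'\<close>. The single sign in the last assumption thus yields both halves of the
  alternation.\<close>

lemma straight_crossing:
  assumes "curve_from D u {u, u'} = linepath a a'" "curve_from D u' {u, u'} = linepath a' a"
    and "curve_from D v {v, v'} = linepath b b'" "curve_from D v' {v, v'} = linepath b' b"
    and p: "p \<in> closed_segment a a'" "p \<in> closed_segment b b'" "p \<notin> {a, a', b, b'}"
    and im: "0 < Im ((b - b') / (a - a'))"
  shows "alternate_at D {u, u'} {v, v'} p"
proof -
  have ne: "a \<noteq> a'" "b \<noteq> b'" using im by auto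
  have param: "\<exists>t. 0 < t \<and> t < 1 \<and> p = linepath x y t"
    if xy: "p \<in> closed_segment x y" "p \<noteq> x" "p \<noteq> y" for x y
  proof -
    obtain t where t: "t \<in> {0..1}" "p = linepath x y t"
      using xy(1) by (auto simp: closed_segment_def linepath_def)
    then have "t \<noteq> 0" "t \<noteq> 1" using xy by (auto simp: linepath_0' linepath_1')
    then show ?thesis using t by (intro exI[of _ t]) auto
  qed
  have exitv: "exit_vector (arm D p e w) r = of_real (r / cmod (x - y)) * (x - y)"
    if "curve_from D w e = linepath x y" "p \<in> closed_segment x y" "p \<noteq> x" "p \<noteq> y" "x \<noteq> y"
      "0 < r" "r < dist p x" for e w x y r
    using param[OF that(2-4)] arm_linepath_exit[OF that(1,5) _ _ _ that(6,7)] by blast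
  define \<rho> where "\<rho> = Min {dist p a, dist p a', dist p b, dist p b'}"
  have \<rho>: "0 < \<rho>" "\<rho> \<le> dist p a" "\<rho> \<le> dist p a'" "\<rho> \<le> dist p b" "\<rho> \<le> dist p b'"
    using p(3) by (auto simp: \<rho>_def)
  have p': "p \<in> closed_segment a' a" "p \<in> closed_segment b' b"
    using p by (simp_all add: closed_segment_commute)
  have im': "0 < Im ((b' - b) / (a' - a))"
    using im by (metis minus_diff_eq minus_divide_divide)
  have 1: "ccw (arm D p {u, u'} u) (arm D p {v, v'} v) (arm D p {u, u'} u')"
    by (rule ccw_scaled[OF \<rho>(1) _ _ _ im, of "cmod (a - a')" "cmod (b - b')" "cmod (a' - a)" "a' - a"])
      (use ne p p' \<rho> in \<open>simp_all add: exitv assms(1-4)\<close>)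
  have 2: "ccw (arm D p {u, u'} u') (arm D p {v, v'} v') (arm D p {u, u'} u)"
    by (rule ccw_scaled[OF \<rho>(1) _ _ _ im', of "cmod (a' - a)" "cmod (b' - b)" "cmod (a - a')" "a - a'"])
      (use ne p p' \<rho> in \<open>simp_all add: exitv assms(1-4)\<close>)
  show ?thesis unfolding alternate_at_def using 1 2 by blast
qed

text \<open>The picture is symmetric about the line \<open>Re z = 5\<close>. Vertices 0, 1, 5, 6 lie
  on the real axis, which cuts the slanted sides of the triangle at 3 and 7, so 4 and 6 are inside
  and the connecting edges cross there. The abscissae of vertices 0 to 5 are distinct integers
  between 0 and 9, which keeps translated copies by multiples of 10 apart.\<close>

definition off :: "nat \<Rightarrow> complex" where
  "off x = [Complex 0 0, Complex 4 0, Complex 5 4, Complex 9 (-4), Complex 1 (-4), Complex 6 0, Complex 10 0] ! x"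

lemma off_simps [simp]:
  "off 0 = 0" "off (Suc 0) = 4" "off 2 = Complex 5 4" "off 3 = Complex 9 (-4)" "off 4 = Complex 1 (-4)"
  "off 5 = 6" "off 6 = 10"
  by (auto simp: off_def complex_eq_iff)

text \<open>Twice the signed area of the triangle \<open>a b c\<close>: positive for a left turn,
  zero for collinear points, and affine in \<open>c\<close>.\<close>

definition orient :: "complex \<Rightarrow> complex \<Rightarrow> complex \<Rightarrow> real" where
  "orient a b c = (Re b - Re a) * (Im c - Im a) - (Im b - Im a) * (Re c - Re a)"

lemma orient_segment:
  assumes "z \<in> closed_segment c d"
  obtains t where "0 \<le> t" "t \<le> 1" "z = (1 - t) *\<^sub>R c + t *\<^sub>R d"
    "\<And>a b. orient a b z = (1 - t) * orient a b c + t * orient a b d"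
proof -
  obtain t where t: "0 \<le> t" "t \<le> 1" "z = (1 - t) *\<^sub>R c + t *\<^sub>R d"
    using assms by (auto simp: closed_segment_def)
  have "orient a b z = (1 - t) * orient a b c + t * orient a b d" for a b
    unfolding t(3) by (simp add: orient_def algebra_simps)
  with t show thesis by (rule that)
qed

lemma orient_zero: "z \<in> closed_segment a b \<Longrightarrow> orient a b z = 0"
  by (auto simp: closed_segment_def orient_def) (simp add: algebra_simps)

text \<open>On the line through \<open>a\<close> and \<open>b\<close> the orientation vanishes,
  while at \<open>z\<close> it is a convex combination of its values at \<open>c\<close> and
  \<open>d\<close>. These cannot have the same strict sign, and if just one of them vanishes, all
  the weight lies there.\<close>

lemma segments_meet:
  assumes z: "z \<in> closed_segment a b" "z \<in> closed_segment c d"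
  shows "orient a b c * orient a b d \<le> 0"
    and "orient a b c = 0 \<Longrightarrow> orient a b d \<noteq> 0 \<Longrightarrow> z = c"
    and "orient a b d = 0 \<Longrightarrow> orient a b c \<noteq> 0 \<Longrightarrow> z = d"
proof -
  obtain t where t: "0 \<le> t" "t \<le> 1" "z = (1 - t) *\<^sub>R c + t *\<^sub>R d"
    "(1 - t) * orient a b c + t * orient a b d = 0"
    using orient_segment[OF z(2)] orient_zero[OF z(1)] by metis
  show "orient a b c * orient a b d \<le> 0"
  proof (rule ccontr)
    assume "\<not> ?thesis"
    then have "0 < orient a b c \<and> 0 < orient a b d \<or> orient a b c < 0 \<and> orient a b d < 0"
      by (simp add: not_le zero_less_mult_iff)
    then show False
    proof
      assume "0 < orient a b c \<and> 0 < orient a b d"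
      then have "(1 - t) * - orient a b c + t * - orient a b d < 0"
        using convex_bound_lt[of "- orient a b c" 0 "- orient a b d" "1 - t" t] t by simp
      then show False using t(4) by simp
    next
      assume "orient a b c < 0 \<and> orient a b d < 0"
      then have "(1 - t) * orient a b c + t * orient a b d < 0"
        using convex_bound_lt[of "orient a b c" 0 "orient a b d" "1 - t" t] t by simp
      then show False using t(4) by simp
    qed
  qed
  show "z = c" if "orient a b c = 0" "orient a b d \<noteq> 0"
    using t(3,4) that by simp
  show "z = d" if "orient a b d = 0" "orient a b c \<noteq> 0"
    using t(3,4) that by simp
qed

lemma segment_bounds:
  assumes "z \<in> closed_segment a b"
  shows "min (Re a) (Re b) \<le> Re z" "Re z \<le> max (Re a) (Re b)"
    "min (Im a) (Im b) \<le> Im z" "Im z \<le> max (Im a) (Im b)"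
proof -
  have "Re z \<in> closed_segment (Re a) (Re b)" "Im z \<in> closed_segment (Im a) (Im b)"
    using assms by (auto simp: closed_segment_def)
  then show "min (Re a) (Re b) \<le> Re z" "Re z \<le> max (Re a) (Re b)"
    "min (Im a) (Im b) \<le> Im z" "Im z \<le> max (Im a) (Im b)"
    by (auto simp: closed_segment_eq_real_ivl split: if_splits)
qed

text \<open>An entry \<open>(u, u', v, v', w)\<close> stands for the edges \<open>u u'\<close> and \<open>v v'\<close> crossing at \<open>w\<close>, where
  \<open>v\<close> follows \<open>u\<close> counterclockwise.\<close>

definition crossings :: "(nat \<times> nat \<times> nat \<times> nat \<times> complex) set" where
  "crossings = {(0, 1, 4, 2, 3), (2, 4, 0, 1, 3), (5, 6, 3, 2, 7), (2, 3, 5, 6, 7),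
     (1, 3, 4, 5, Complex 5 (-4/5)), (4, 5, 3, 1, Complex 5 (-4/5))}"

lemma gadget_vertex_on_edge:
  assumes "(x, y) \<in> gadget_edges" "v \<le> 6" "off v \<in> closed_segment (off x) (off y)"
  shows "v = x \<or> v = y"
proof -
  have "v \<in> {0, 1, 2, 3, 4, 5, 6}" using assms(2) by auto
  with assms(1) orient_zero[OF assms(3)] segment_bounds[OF assms(3)] show ?thesis
    unfolding gadget_edges_def by (elim insertE emptyE) (simp_all add: orient_def)
qed

text \<open>A common point that is no vertex requires, for each edge, that the ends of the other are
  strictly separated by its line or both lie on it. Signs decide this for all pairs of edges;
  comparing abscissae excludes the collinear edges 01 and 56. The vanishing of both orientations
  then determines the crossing point.\<close>

lemma gadget_edges_meet:
  assumes e: "(x, y) \<in> gadget_edges" and f: "(x', y') \<in> gadget_edges" and ne: "(x, y) \<noteq> (x', y')"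
    and z: "z \<in> closed_segment (off x) (off y)" "z \<in> closed_segment (off x') (off y')"
    and nv: "z \<notin> off ` {..6}"
  shows "\<exists>(u, u', v, v', w)\<in>crossings. {x, y} = {u, u'} \<and> {x', y'} = {v, v'} \<and> z = w"
proof -
  have xy: "z \<noteq> off x'" "z \<noteq> off y'" "z \<noteq> off x" "z \<noteq> off y"
    using nv gadget_edges_bounds[OF e] gadget_edges_bounds[OF f] by auto
  let ?o = "\<lambda>x y z. orient (off x) (off y) (off z)"
  have o: "?o x y x' * ?o x y y' < 0 \<or> ?o x y x' = 0 \<and> ?o x y y' = 0"
    "?o x' y' x * ?o x' y' y < 0 \<or> ?o x' y' x = 0 \<and> ?o x' y' y = 0"
    using segments_meet[OF z] segments_meet[OF z(2,1)] xy
    by (auto simp: less_le)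
  have z0: "orient (off x) (off y) z = 0" "orient (off x') (off y') z = 0"
    using z orient_zero by auto
  have re: "min (Re (off x)) (Re (off y)) \<le> max (Re (off x')) (Re (off y'))"
    "min (Re (off x')) (Re (off y')) \<le> max (Re (off x)) (Re (off y))"
    using segment_bounds(1,2)[OF z(1)] segment_bounds(1,2)[OF z(2)] by linarith+
  have "(x, y, x', y') \<in> {(0, 1, 2, 4), (2, 4, 0, 1), (5, 6, 2, 3), (2, 3, 5, 6), (1, 3, 4, 5), (4, 5, 1, 3)}"
    using e f ne o re unfolding gadget_edges_def
    by (elim insertE emptyE) (simp_all add: orient_def)
  then show ?thesis using z0
    by (elim insertE emptyE) (auto simp: crossings_def orient_def complex_eq_iff)
qed

section \<open>Placing the gadgets side by side\<close>

definition pt :: "nat \<Rightarrow> nat \<Rightarrow> complex" where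
  "pt m v = (if v \<le> 6 * m then of_nat (10 * (v div 6)) + off (v mod 6)
     else Complex (if v = 6 * m + 1 then of_nat (10 * m) else 0) 5)"

definition ring_drawing :: "nat \<Rightarrow> nat drawing" where
  "ring_drawing m = \<lparr>point = pt m, curve = \<lambda>e. linepath (pt m (Min e)) (pt m (Max e))\<rparr>"

lemma point_ring_drawing [simp]: "point (ring_drawing m) = pt m"
  by (simp add: ring_drawing_def)

text \<open>A shared vertex is offset 6 of one gadget and offset 0 of the next. The two readings
  agree because \<open>off 6 = 10\<close> is the width of the translation.\<close>

lemma pt_gadget:
  assumes "i < m" "x \<le> 6"
  shows "pt m (6 * i + x) = of_nat (10 * i) + off x"
proof (cases "x = 6")
  case True
  then have eq: "6 * i + x = 6 * Suc i" by simp
  have "pt m (6 * Suc i) = of_nat (10 * i) + off 6"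
    using assms by (simp add: pt_def)
  then show ?thesis using eq True by metis
next
  case False
  then have "x < 6" using assms by simp
  then have "(6 * i + x) div 6 = i" "(6 * i + x) mod 6 = x" "6 * i + x \<le> 6 * m"
    using assms by auto
  then show ?thesis by (simp add: pt_def)
qed

lemma pt_outer: "pt m 0 = 0" "pt m (6 * m) = of_nat (10 * m)"
    "pt m (6 * m + 1) = Complex (of_nat (10 * m)) 5" "pt m (6 * m + 2) = Complex 0 5"
  by (auto simp: pt_def)

lemma pt_cases:
  assumes "v \<le> 6 * m + 2"
  obtains j r where "j \<le> m" "r \<le> 5" "v = 6 * j + r" "pt m v = of_nat (10 * j) + off r" "j = m \<longrightarrow> r = 0"
  | "v = 6 * m + 1" | "v = 6 * m + 2"
proof (cases "v \<le> 6 * m")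
  case True
  show thesis
  proof (rule that(1)[of "v div 6" "v mod 6"])
    show "v div 6 \<le> m" using True by linarith
    show "v div 6 = m \<longrightarrow> v mod 6 = 0" using True mult_div_mod_eq[of 6 v] by linarith
  qed (use True in \<open>auto simp: pt_def\<close>)
qed (use assms that in linarith)

lemma off_bounds:
  assumes "r \<le> 5"
  shows "0 \<le> Re (off r)" "Re (off r) \<le> 9" "Re (off r) = 0 \<Longrightarrow> r = 0" "\<bar>Im (off r)\<bar> \<le> 4"
    "\<exists>k\<le>9. Re (off r) = of_nat k" "r' \<le> 5 \<Longrightarrow> Re (off r) = Re (off r') \<Longrightarrow> r = r'"
proof -
  have r: "r \<in> {0, 1, 2, 3, 4, 5}" using assms by auto
  then show "0 \<le> Re (off r)" "Re (off r) \<le> 9" "Re (off r) = 0 \<Longrightarrow> r = 0" "\<bar>Im (off r)\<bar> \<le> 4"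
    by auto
  show "\<exists>k\<le>9. Re (off r) = of_nat k"
    using r by (auto intro: exI[of _ 0] exI[of _ 4] exI[of _ 5] exI[of _ 9] exI[of _ 1] exI[of _ 6])
  show "r = r'" if "r' \<le> 5" "Re (off r) = Re (off r')"
  proof -
    have "r' \<in> {0, 1, 2, 3, 4, 5}" using that(1) by auto
    then show ?thesis using r that(2) by auto
  qed
qed

lemma Im_pt: "v \<le> 6 * m \<Longrightarrow> \<bar>Im (pt m v)\<bar> \<le> 4" "6 * m < v \<Longrightarrow> Im (pt m v) = 5"
  using off_bounds(4)[of "v mod 6"] by (simp_all add: pt_def)

text \<open>The abscissa of a gadget vertex is an integer \<open>10 * j + k\<close> with
  \<open>k \<le> 9\<close>, so it determines \<open>j\<close> and \<open>k\<close>, and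
  \<open>k\<close> determines the offset. The closing vertices are higher than the rest, and
  \<open>m > 0\<close> keeps these two apart.\<close>

lemma inj_pt:
  assumes "m > 0"
  shows "inj_on (pt m) {..6 * m + 2}"
proof (rule inj_onI)
  fix v w assume v: "v \<in> {..6 * m + 2}" and w: "w \<in> {..6 * m + 2}" and eq: "pt m v = pt m w"
  from v have v: "v \<le> 6 * m + 2" by simp
  from w have w: "w \<le> 6 * m + 2" by simp
  show "v = w"
  proof (cases "v \<le> 6 * m \<and> w \<le> 6 * m")
    case True
    obtain j r where v: "r \<le> 5" "v = 6 * j + r" "pt m v = of_nat (10 * j) + off r"
      using v by (cases rule: pt_cases) (use True in auto)
    obtain i s where w: "s \<le> 5" "w = 6 * i + s" "pt m w = of_nat (10 * i) + off s"
      using w by (cases rule: pt_cases) (use True in auto)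
    obtain k l where kl: "k \<le> 9" "Re (off r) = of_nat k" "l \<le> 9" "Re (off s) = of_nat l"
      using off_bounds(5) v w by metis
    have "Re (pt m v) = Re (pt m w)" using eq by simp
    then have "real (10 * j + k) = real (10 * i + l)" using v w kl by simp
    then have *: "10 * j + k = 10 * i + l" by (simp only: of_nat_eq_iff)
    then have "j = i" using kl by linarith
    then have "k = l" using * by simp
    then have "r = s" using off_bounds(6)[of r s] v w kl by simp
    then show ?thesis using v w \<open>j = i\<close> by simp
  next
    case False
    then have "6 * m < v \<and> 6 * m < w"
      using Im_pt(1)[of v m] Im_pt(2)[of m v] Im_pt(1)[of w m] Im_pt(2)[of m w] eq by (cases "v \<le> 6 * m"; cases "w \<le> 6 * m") auto
    then show ?thesis using v w eq assms by (auto simp: pt_def split: if_splits)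
  qed
qed

lemma curve_ring_drawing:
  "curve (ring_drawing m) {u, v} = linepath (pt m u) (pt m v) \<or>
   curve (ring_drawing m) {u, v} = linepath (pt m v) (pt m u)"
  by (cases "u \<le> v") (auto simp: ring_drawing_def min_def max_def)

lemma path_image_ring_drawing:
  "path_image (curve (ring_drawing m) {u, v}) = closed_segment (pt m u) (pt m v)"
  using curve_ring_drawing[of m u v] by (auto simp: closed_segment_commute)

lemma curve_from_ring_drawing:
  assumes "pt m u \<noteq> pt m v"
  shows "curve_from (ring_drawing m) u {u, v} = linepath (pt m u) (pt m v)"
    "curve_from (ring_drawing m) v {u, v} = linepath (pt m v) (pt m u)"
  using curve_ring_drawing[of m u v] assms by (auto simp: curve_from_def)

lemma gadget_segment:
  assumes "i < m" "x \<le> 6" "y \<le> 6"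
  shows "z \<in> closed_segment (pt m (6 * i + x)) (pt m (6 * i + y)) \<longleftrightarrow>
    z - of_nat (10 * i) \<in> closed_segment (off x) (off y)"
proof -
  have "closed_segment (pt m (6 * i + x)) (pt m (6 * i + y)) =
      (+) (of_nat (10 * i)) ` closed_segment (off x) (off y)"
    using assms by (simp only: pt_gadget closed_segment_translation)
  then show ?thesis by (auto simp: image_iff algebra_simps) (metis add_diff_cancel_left' diff_add_cancel add.commute)
qed

lemma gadget_edge_segment:
  assumes "i < m" "(x, y) \<in> gadget_edges"
  shows "z \<in> path_image (curve (ring_drawing m) {6 * i + x, 6 * i + y}) \<longleftrightarrow>
    z - of_nat (10 * i) \<in> closed_segment (off x) (off y)"
proof -
  have "x \<le> 6" "y \<le> 6" using gadget_edges_bounds[OF assms(2)] by auto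
  then show ?thesis unfolding path_image_ring_drawing by (intro gadget_segment assms)
qed

text \<open>The box around a gadget touches the neighbouring boxes along vertical lines, and the
  gadget reaches these lines only at its shared vertices. Thus edges of different gadgets have no
  other common points.\<close>

lemma gadget_box:
  assumes e: "(x, y) \<in> gadget_edges" and w: "w \<in> closed_segment (off x) (off y)"
  shows "0 \<le> Re w" "Re w \<le> 10" "\<bar>Im w\<bar> \<le> 4" "Re w = 0 \<Longrightarrow> w = off 0" "Re w = 10 \<Longrightarrow> w = off 6"
  using e segment_bounds[OF w] unfolding gadget_edges_def
  by (elim insertE emptyE; simp add: complex_eq_iff)+

lemma ring_vertex_on_edge:
  assumes m: "m > 0" and e: "e \<in> edges (ring m)" and v: "v \<le> 6 * m + 2"
    and on: "pt m v \<in> path_image (curve (ring_drawing m) e)"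
  shows "v \<in> e"
  using e
proof (cases rule: ring_edge_cases)
  case e: (1 i x y)
  define w where "w = pt m v - of_nat (10 * i)"
  have w: "w \<in> closed_segment (off x) (off y)"
    using on e(3) gadget_edge_segment[OF e(1,2)] by (simp only: w_def)
  note box = gadget_box[OF e(2) w]
  from v show ?thesis
  proof (cases rule: pt_cases)
    case v: (1 j r)
    have Re: "Re w = 10 * real j - 10 * real i + Re (off r)" using v(4) by (simp add: w_def)
    consider "j = i" | "j < i" | "i < j" by linarith
    then show ?thesis
    proof cases
      case 1
      then have "w = off r" using v(4) by (simp add: w_def)
      then show ?thesis using gadget_vertex_on_edge[OF e(2), of r] w v 1 e(3) by auto
    next
      case 2
      then have "real j + 1 \<le> real i" by linarith
      then have False using Re box(1) off_bounds(2)[OF v(2)] by linarith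
      then show ?thesis ..
    next
      case 3
      then have "real i + 1 \<le> real j" by linarith
      then have j: "real j = real i + 1" "Re (off r) = 0" "Re w = 10"
        using Re box(2) off_bounds(1)[OF v(2)] by linarith+
      then have "r = 0" "j = i + 1" using off_bounds(3)[OF v(2)] by auto
      then have "off 6 \<in> closed_segment (off x) (off y)" using w box(5)[OF j(3)] by simp
      then have "6 = x \<or> 6 = y" using gadget_vertex_on_edge[OF e(2), of 6] by simp
      then show ?thesis using v(3) \<open>r = 0\<close> \<open>j = i + 1\<close> e(3) by auto
    qed
  qed (use box(3) pt_outer in \<open>auto simp: w_def\<close>)
next
  case 2
  have "Re (pt m v) = 10 * m"
    using on pt_outer segment_bounds(1,2)[of "pt m v" "pt m (6 * m)" "pt m (6 * m + 1)"]
    by (simp add: 2 path_image_ring_drawing del: add_Suc_right)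
  from v show ?thesis
  proof (cases rule: pt_cases)
    case v: (1 j r)
    have "j = m"
    proof (rule ccontr)
      assume "j \<noteq> m"
      then have "real j + 1 \<le> real m" using v(1) by linarith
      then show False using v(4) \<open>Re (pt m v) = 10 * m\<close> off_bounds(2)[OF v(2)] by simp
    qed
    then show ?thesis using v 2 by simp
  qed (use 2 \<open>Re (pt m v) = 10 * m\<close> pt_outer m in auto)
next
  case 3
  have "Im (pt m v) = 5"
    using on pt_outer segment_bounds(3,4)[of "pt m v" "pt m (6 * m + 1)" "pt m (6 * m + 2)"]
    by (simp add: 3 path_image_ring_drawing del: add_Suc_right add_2_eq_Suc')
  from v show ?thesis
  proof (cases rule: pt_cases)
    case v: (1 j r)
    then show ?thesis using \<open>Im (pt m v) = 5\<close> off_bounds(4)[OF v(2)] by simp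
  qed (use 3 in auto)
next
  case 4
  have "Re (pt m v) = 0"
    using on pt_outer segment_bounds(1,2)[of "pt m v" "pt m 0" "pt m (6 * m + 2)"]
    by (simp add: 4 path_image_ring_drawing del: add_2_eq_Suc')
  from v show ?thesis
  proof (cases rule: pt_cases)
    case v: (1 j r)
    then have "real j = 0" "Re (off r) = 0"
      using \<open>Re (pt m v) = 0\<close> off_bounds(1)[OF v(2)] by simp_all
    then show ?thesis using v 4 off_bounds(3)[OF v(2)] by simp
  qed (use 4 \<open>Re (pt m v) = 0\<close> pt_outer m in auto)
qed

text \<open>Away from vertices, the gadgets occupy disjoint open vertical strips, and the closing
  edges run along the borders \<open>Re p = 0\<close>, \<open>Re p = 10 * real m\<close> and
  \<open>Im p = 5\<close>. Hence a crossing can only occur between two edges of one gadget.\<close>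

lemma ring_edge_region:
  assumes e: "e \<in> edges (ring m)" and p: "p \<in> path_image (curve (ring_drawing m) e)"
    and nv: "p \<notin> pt m ` {..6 * m + 2}"
  obtains i x y where "i < m" "(x, y) \<in> gadget_edges" "e = {6 * i + x, 6 * i + y}"
      "p - of_nat (10 * i) \<in> closed_segment (off x) (off y)"
      "10 * real i < Re p" "Re p < 10 * real i + 10" "\<bar>Im p\<bar> \<le> 4"
  | "e = {6 * m, 6 * m + 1}" "Re p = 10 * real m" "Im p < 5"
  | "e = {6 * m + 1, 6 * m + 2}" "Im p = 5"
  | "e = {0, 6 * m + 2}" "Re p = 0" "Im p < 5"
  using e
proof (cases rule: ring_edge_cases)
  case e: (1 i x y)
  let ?w = "p - of_nat (10 * i)"
  have w: "?w \<in> closed_segment (off x) (off y)"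
    using p e(3) gadget_edge_segment[OF e(1,2)] by (simp only:)
  note box = gadget_box[OF e(2) w]
  have "?w \<noteq> off 0"
  proof
    assume "?w = off 0"
    then have "p = pt m (6 * i + 0)" unfolding pt_gadget[OF e(1) le0] by simp
    then show False using nv e(1) by auto
  qed
  moreover have "?w \<noteq> off 6"
  proof
    assume "?w = off 6"
    then have "p = pt m (6 * i + 6)" unfolding pt_gadget[OF e(1) order_refl] by (simp add: algebra_simps)
    then show False using nv e(1) by auto
  qed
  ultimately have "0 < Re ?w" "Re ?w < 10" using box by (auto simp: less_le)
  then show thesis using box(3) by (intro that(1)[OF e w]) auto
next
  case 2
  have b: "Re p = 10 * real m" "0 \<le> Im p" "Im p \<le> 5"
    using p pt_outer segment_bounds[of p "pt m (6 * m)" "pt m (6 * m + 1)"]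
    by (simp_all add: 2 path_image_ring_drawing del: add_Suc_right)
  moreover have "Im p \<noteq> 5"
  proof
    assume "Im p = 5"
    then have "p = pt m (6 * m + 1)" using b pt_outer by (simp add: complex_eq_iff)
    then show False using nv by auto
  qed
  ultimately show thesis using that(2) 2 by simp
next
  case 3
  have "Im p = 5"
    using p pt_outer segment_bounds(3,4)[of p "pt m (6 * m + 1)" "pt m (6 * m + 2)"]
    by (simp add: 3 path_image_ring_drawing del: add_Suc_right add_2_eq_Suc')
  then show thesis using that(3) 3 by simp
next
  case 4
  have b: "Re p = 0" "0 \<le> Im p" "Im p \<le> 5"
    using p pt_outer segment_bounds[of p "pt m 0" "pt m (6 * m + 2)"]
    by (simp_all add: 4 path_image_ring_drawing del: add_2_eq_Suc')
  moreover have "Im p \<noteq> 5"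
  proof
    assume "Im p = 5"
    then have "p = pt m (6 * m + 2)" using b pt_outer by (simp add: complex_eq_iff)
    then show False using nv by auto
  qed
  ultimately show thesis using that(4) 4 by simp
qed

section \<open>Crossings and outer face of the straight-line drawing\<close>

lemma ring_meet:
  assumes m: "m > 0" and meet: "meet_at (ring m) (ring_drawing m) e f p"
  shows "\<exists>i<m. \<exists>(u, u', v, v', w)\<in>crossings.
    e = {6 * i + u, 6 * i + u'} \<and> f = {6 * i + v, 6 * i + v'} \<and> p = of_nat (10 * i) + w"
proof -
  have e: "e \<in> edges (ring m)" "p \<in> path_image (curve (ring_drawing m) e)"
    and f: "f \<in> edges (ring m)" "p \<in> path_image (curve (ring_drawing m) f)"
    and nv: "p \<notin> pt m ` {..6 * m + 2}" and ef: "e \<noteq> f"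
    using meet by (auto simp: meet_at_def)
  have strip: False if "10 * real i < 10 * real j" "10 * real j < 10 * real i + 10" for i j :: nat
    using that by (simp add: less_Suc_eq_le flip: of_nat_Suc)
  from e nv show ?thesis
  proof (cases rule: ring_edge_region)
    case e: (1 i x y)
    from f nv show ?thesis
    proof (cases rule: ring_edge_region)
      case f: (1 j x' y')
      have "real i < real j + 1" "real j < real i + 1" using e(5,6) f(5,6) by linarith+
      then have ij: "j = i" by linarith
      have ne: "(x, y) \<noteq> (x', y')" using ef e(3) f(3) ij by auto
      have "p - of_nat (10 * i) \<notin> off ` {..6}"
      proof
        assume "p - of_nat (10 * i) \<in> off ` {..6}"
        then obtain r where r: "r \<le> 6" "p - of_nat (10 * i) = off r" by auto
        then have "p = pt m (6 * i + r)" unfolding pt_gadget[OF e(1) r(1)] by (simp add: algebra_simps)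
        moreover have "6 * i + r \<le> 6 * m + 2" using r e(1) by linarith
        ultimately show False using nv by blast
      qed
      from gadget_edges_meet[OF e(2) f(2) ne e(4) f(4)[unfolded ij] this]
      obtain u u' v v' w where c: "(u, u', v, v', w) \<in> crossings" "{x, y} = {u, u'}"
        "{x', y'} = {v, v'}" "p - of_nat (10 * i) = w" by auto
      have "(\<lambda>s. 6 * i + s) ` {x, y} = (\<lambda>s. 6 * i + s) ` {u, u'}"
        "(\<lambda>s. 6 * i + s) ` {x', y'} = (\<lambda>s. 6 * i + s) ` {v, v'}" using c by simp_all
      then have "e = {6 * i + u, 6 * i + u'}" "f = {6 * i + v, 6 * i + v'}"
        using e(3) f(3) ij by simp_all
      moreover have "p = of_nat (10 * i) + w" using c(4) by (simp add: algebra_simps)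
      ultimately show ?thesis using c(1) e(1) by (intro exI[of _ i]) auto
    next
      case 2
      then show ?thesis using strip[of i m] e by simp
    next
      case 3
      then show ?thesis using e by simp
    next
      case 4
      then show ?thesis using e by simp
    qed
  next
    case e: 2
    from f nv show ?thesis
    proof (cases rule: ring_edge_region)
      case (1 j x' y')
      then show ?thesis using strip[of j m] e by simp
    qed (use e ef m in auto)
  next
    case e: 3
    from f nv show ?thesis
      by (cases rule: ring_edge_region) (use e ef m in auto)
  next
    case e: 4
    from f nv show ?thesis
      by (cases rule: ring_edge_region) (use e ef m in auto)
  qed
qed

lemma crossings_bounds:
  assumes "(u, u', v, v', w) \<in> crossings"
  shows "u \<le> 6" "u' \<le> 6" "v \<le> 6" "v' \<le> 6" "u < u'" "{u, u'} \<inter> {v, v'} = {}"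
    "0 < Im ((off v - off v') / (off u - off u'))"
  using assms by (auto simp: crossings_def Im_divide)

lemma segmentI:
  assumes "orient a b z = 0" "min (Re a) (Re b) \<le> Re z" "Re z \<le> max (Re a) (Re b)" "Re a \<noteq> Re b"
  shows "z \<in> closed_segment a b"
proof -
  define t where "t = (Re z - Re a) / (Re b - Re a)"
  have "0 \<le> t" "t \<le> 1"
    using assms(2-4) by (auto simp: t_def divide_simps min_def max_def split: if_splits)
  moreover have t: "t * (Re b - Re a) = Re z - Re a" using assms(4) by (simp add: t_def)
  have "Im z - Im a = t * (Im b - Im a)"
    using assms(1,4) by (simp add: t_def orient_def field_simps)
  with t have "z = (1 - t) *\<^sub>R a + t *\<^sub>R b" by (simp add: complex_eq_iff algebra_simps)
  ultimately show ?thesis by (auto simp: closed_segment_def)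
qed

lemma crossings_on_segments:
  assumes "(u, u', v, v', w) \<in> crossings"
  shows "w \<in> closed_segment (off u) (off u')" "w \<in> closed_segment (off v) (off v')"
  using assms unfolding crossings_def
  by (auto intro!: segmentI simp: orient_def)

text \<open>A crossed edge has an end with offset 1 to 5, so it identifies its gadget. Each crossed
  edge of a gadget is the first edge of only one entry of \<open>crossings\<close>; this is what
  makes the drawing 1-planar.\<close>

lemma crossings_unique:
  assumes "(u, u', v, v', w) \<in> crossings" "(s, s', t, t', z) \<in> crossings"
    and "6 * i + u = 6 * j + s" "6 * i + u' = 6 * j + s'"
  shows "i = j" "{v, v'} = {t, t'}" "w = z"
proof -
  have "1 \<le> u \<and> u \<le> 5 \<or> 1 \<le> u' \<and> u' \<le> 5" using assms(1) by (auto simp: crossings_def)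
  then show "i = j"
    using gadget_index(1)[of i u j s] gadget_index(1)[of i u' j s'] crossings_bounds[OF assms(2)] assms(3,4) by auto
  then have "u = s" "u' = s'" using assms(3,4) by auto
  then show "{v, v'} = {t, t'}" "w = z" using assms(1,2) by (auto simp: crossings_def)
qed

lemma one_planar_ring_drawing:
  assumes m: "m > 0"
  shows "one_planar_drawing (ring m) (ring_drawing m)"
proof -
  let ?G = "ring m" and ?D = "ring_drawing m"
  have pt_ne: "pt m u \<noteq> pt m v" if "u \<noteq> v" "u \<le> 6 * m + 2" "v \<le> 6 * m + 2" for u v
    using inj_pt[OF m] that by (auto simp: inj_on_def)
  have "arc (curve ?D e) \<and> {pathstart (curve ?D e), pathfinish (curve ?D e)} = point ?D ` e"
    if "e \<in> edges ?G" for e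
  proof -
    have "card e = 2" "e \<subseteq> verts ?G" using that simple_graph_ring by (auto simp: simple_graph_def)
    then obtain u v where uv: "e = {u, v}" "u \<noteq> v" "u \<le> 6 * m + 2" "v \<le> 6 * m + 2"
      by (auto simp: card_2_iff)
    then show ?thesis using curve_ring_drawing[of m u v] pt_ne[of u v] by (auto simp: arc_linepath)
  qed
  moreover have "v \<in> e" if "e \<in> edges ?G" "v \<in> verts ?G" "point ?D v \<in> path_image (curve ?D e)" for e v
    using ring_vertex_on_edge[OF m that(1)] that(2,3) by simp
  moreover have "e \<inter> f = {} \<and> alternate_at ?D e f p" if meet: "meet_at ?G ?D e f p" for e f p
  proof -
    obtain i u u' v v' w where i: "i < m" and c: "(u, u', v, v', w) \<in> crossings"
      and e: "e = {6 * i + u, 6 * i + u'}" and f: "f = {6 * i + v, 6 * i + v'}"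
      using ring_meet[OF m meet] by auto
    note b = crossings_bounds[OF c]
    have le: "6 * i + x \<le> 6 * m + 2" if "x \<le> 6" for x using that i by linarith
    have vv: "v \<noteq> v'" using b(7) by auto
    have nv: "p \<notin> pt m ` {..6 * m + 2}" and on: "p \<in> path_image (curve ?D e)" "p \<in> path_image (curve ?D f)"
      using meet by (auto simp: meet_at_def)
    have ne: "pt m (6 * i + u) \<noteq> pt m (6 * i + u')" "pt m (6 * i + v) \<noteq> pt m (6 * i + v')"
      using pt_ne[OF _ le[OF b(1)] le[OF b(2)]] pt_ne[OF _ le[OF b(3)] le[OF b(4)]] b(5) vv by auto
    have "alternate_at ?D {6 * i + u, 6 * i + u'} {6 * i + v, 6 * i + v'} p"
    proof (rule straight_crossing)
      show "curve_from ?D (6 * i + u) {6 * i + u, 6 * i + u'} = linepath (pt m (6 * i + u)) (pt m (6 * i + u'))"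
        "curve_from ?D (6 * i + v) {6 * i + v, 6 * i + v'} = linepath (pt m (6 * i + v)) (pt m (6 * i + v'))"
        by (rule curve_from_ring_drawing(1), rule ne)+
      show "curve_from ?D (6 * i + u') {6 * i + u, 6 * i + u'} = linepath (pt m (6 * i + u')) (pt m (6 * i + u))"
        "curve_from ?D (6 * i + v') {6 * i + v, 6 * i + v'} = linepath (pt m (6 * i + v')) (pt m (6 * i + v))"
        by (rule curve_from_ring_drawing(2), rule ne)+
      show "p \<in> closed_segment (pt m (6 * i + u)) (pt m (6 * i + u'))"
        "p \<in> closed_segment (pt m (6 * i + v)) (pt m (6 * i + v'))"
        using on by (simp_all only: e f path_image_ring_drawing)
      show "p \<notin> {pt m (6 * i + u), pt m (6 * i + u'), pt m (6 * i + v), pt m (6 * i + v')}"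
        using nv le b(1-4) by auto
      show "0 < Im ((pt m (6 * i + v) - pt m (6 * i + v')) / (pt m (6 * i + u) - pt m (6 * i + u')))"
        using b(7) by (simp only: pt_gadget[OF i] b(1-4) add_diff_cancel_left)
    qed
    then show ?thesis using b(6) e f by auto
  qed
  ultimately have "is_drawing ?G ?D"
    using inj_pt[OF m] unfolding is_drawing_def by simp
  moreover have "f = f' \<and> p = p'" if meet: "meet_at ?G ?D e f p" "meet_at ?G ?D e f' p'" for e f f' p p'
  proof -
    obtain i u u' v v' w where c: "(u, u', v, v', w) \<in> crossings"
      and e: "e = {6 * i + u, 6 * i + u'}" and f: "f = {6 * i + v, 6 * i + v'}" "p = of_nat (10 * i) + w"
      using ring_meet[OF m meet(1)] by auto
    obtain j s s' t t' z where c': "(s, s', t, t', z) \<in> crossings"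
      and e': "e = {6 * j + s, 6 * j + s'}" and f': "f' = {6 * j + t, 6 * j + t'}" "p' = of_nat (10 * j) + z"
      using ring_meet[OF m meet(2)] by auto
    have "6 * i + u = 6 * j + s" "6 * i + u' = 6 * j + s'"
      using e e' crossings_bounds(5)[OF c] crossings_bounds(5)[OF c'] by (auto simp: doubleton_eq_iff)
    note u = crossings_unique[OF c c' this]
    have "(\<lambda>x. 6 * i + x) ` {v, v'} = (\<lambda>x. 6 * i + x) ` {t, t'}" using u(2) by simp
    then show ?thesis using u(1,3) f f' by simp
  qed
  ultimately show ?thesis unfolding one_planar_drawing_def by blast
qed

lemma ring_meet_exists:
  assumes m: "m > 0" and i: "i < m" and c: "(u, u', v, v', w) \<in> crossings"
  shows "\<exists>p. meet_at (ring m) (ring_drawing m) {6 * i + u, 6 * i + u'} {6 * i + v, 6 * i + v'} p"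
proof -
  let ?p = "of_nat (10 * i) + w" and ?e = "{6 * i + u, 6 * i + u'}" and ?f = "{6 * i + v, 6 * i + v'}"
  have "((u, u') \<in> gadget_edges \<or> (u', u) \<in> gadget_edges) \<and> ((v, v') \<in> gadget_edges \<or> (v', v) \<in> gadget_edges)"
    using c unfolding crossings_def by (elim insertE emptyE) (simp_all add: gadget_edges_def)
  moreover have "{6 * i + x, 6 * i + y} \<in> edges (ring m)"
    if "(x, y) \<in> gadget_edges \<or> (y, x) \<in> gadget_edges" for x y
    using that
  proof
    assume "(y, x) \<in> gadget_edges"
    then show ?thesis using gadget_edge[OF i] by (simp only: insert_commute[of "6 * i + x"])
  qed (rule gadget_edge[OF i])
  ultimately have "?e \<in> edges (ring m)" "?f \<in> edges (ring m)" by blast+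
  moreover have "?p \<in> path_image (curve (ring_drawing m) ?e)" "?p \<in> path_image (curve (ring_drawing m) ?f)"
    using crossings_on_segments[OF c] crossings_bounds(1-4)[OF c]
    by (simp_all only: path_image_ring_drawing gadget_segment[OF i] add_diff_cancel_left')
  moreover have disj: "?e \<inter> ?f = {}" using crossings_bounds(6)[OF c] by auto
  \<comment> \<open>A vertex placed at this point would lie on both edges and so be an end of both,
    but the two edges are disjoint.\<close>
  moreover have "?p \<notin> pt m ` {..6 * m + 2}"
  proof
    assume "?p \<in> pt m ` {..6 * m + 2}"
    then obtain x where x: "x \<le> 6 * m + 2" "?p = pt m x" by auto
    then have "x \<in> ?e" "x \<in> ?f" using ring_vertex_on_edge[OF m _ x(1)] calculation by metis+
    then show False using disj by blast
  qed
  ultimately have "meet_at (ring m) (ring_drawing m) ?e ?f ?p" unfolding meet_at_def by auto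
  then show ?thesis ..
qed

text \<open>The whole drawing lies in the half plane \<open>Im z \<le> 5\<close>, so everything
  above belongs to the outer face. The top edge runs along the line \<open>Im z = 5\<close> and is
  approached from above.\<close>

lemma outer_edge_on_boundary:
  assumes m: "m > 0"
  shows "(6 * m + 2, {6 * m + 1, 6 * m + 2}) \<in> outer_face_boundary (ring m) (ring_drawing m)"
proof -
  let ?D = "ring_drawing m" and ?e = "{6 * m + 1, 6 * m + 2}"
  let ?S = "drawn_set (ring m) ?D" and ?H = "{z::complex. Im z \<le> 5}"
  have H: "convex ?H" using convex_halfspace_Im_le[of 5] .
  have pt5: "Im (pt m v) \<le> 5" for v using Im_pt(1)[of v m] Im_pt(2)[of m v] by (cases "v \<le> 6 * m") auto
  have "path_image (curve ?D e) \<subseteq> ?H" if "e \<in> edges (ring m)" for e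
    using that pt5
    by (cases rule: ring_edge_cases)
      (simp_all only: path_image_ring_drawing, (rule closed_segment_subset; simp add: H)+)
  then have "?S \<subseteq> ?H" using pt5 by (auto simp: drawn_set_def)
  then have out: "- ?H \<subseteq> outside ?S" by (rule outside_subset_convex[OF H])
  have "edge_part (ring m) ?D (6 * m + 2) ?e \<subseteq> frontier (outside ?S)"
  proof
    fix z assume "z \<in> edge_part (ring m) ?D (6 * m + 2) ?e"
    then have "z \<in> path_image (curve_from ?D (6 * m + 2) ?e)"
      by (auto simp: edge_part_def path_image_def)
    then have z: "z \<in> path_image (curve ?D ?e)"
      by (simp add: curve_from_def split: if_splits)
    then have "z \<in> ?S" using outer_edges(2)[of m] by (auto simp: drawn_set_def)
    then have "z \<notin> outside ?S" using outside_no_overlap[of ?S] by blast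
    have "Im z = 5"
      using z segment_bounds(3,4)[of z "pt m (6 * m + 1)" "pt m (6 * m + 2)"]
      by (simp only: path_image_ring_drawing pt_outer) simp
    have "z \<in> closure (outside ?S)"
      unfolding closure_approachable
    proof (intro allI impI)
      fix \<epsilon> :: real assume "0 < \<epsilon>"
      then show "\<exists>y\<in>outside ?S. dist y z < \<epsilon>"
        using out \<open>Im z = 5\<close>
        by (intro bexI[of _ "z + Complex 0 (\<epsilon> / 2)"]) (auto simp: dist_norm cmod_def)
    qed
    then show "z \<in> frontier (outside ?S)"
      using \<open>z \<notin> outside ?S\<close> interior_subset unfolding frontier_def by blast
  qed
  then show ?thesis using outer_edges(2)[of m] by (auto simp: outer_face_boundary_def)
qed

section \<open>Layouts of the ring\<close>

lemma gadget_long_edge: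
  assumes m: "m > 0" and i: "i < m"
    and resp: "respects_embedding (ring m) (ring_drawing m) L"
    and C: "orthogonal_layout (ring m) L C"
  shows "\<exists>e\<in>{{6 * i + 2, 6 * i + 3}, {6 * i + 3, 6 * i + 4}, {6 * i + 4, 6 * i + 2}}. 4 \<le> complexity C e"
proof -
  let ?G = "ring m" and ?D = "ring_drawing m"
  let ?a = "6 * i + 2" and ?b = "6 * i + 3" and ?c = "6 * i + 4"
  let ?T = "{{?a, ?b}, {?b, ?c}, {?c, ?a}}"
  have P: "one_planar_drawing ?G L" and same: "same_embedding ?G ?D L"
    using resp by (auto simp: respects_embedding_def)
  have L: "is_drawing ?G L" using P by (simp add: one_planar_drawing_def)
  have flip: "{?c, ?a} = {?a, ?c}" by (rule insert_commute)
  have T: "{?a, ?b} \<in> edges ?G" "{?b, ?c} \<in> edges ?G" "{?c, ?a} \<in> edges ?G"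
    unfolding flip by (rule gadget_edge[OF i], simp add: gadget_edges_def)+
  interpret drawn_triangle ?G L ?a ?b ?c
    by unfold_locales (rule simple_graph_ring L T)+
  have meet_iff: "(\<exists>p. meet_at ?G L e f p) \<longleftrightarrow> (\<exists>p. meet_at ?G ?D e f p)" for e f
    using same by (simp add: same_embedding_def)
  \<comment> \<open>The crossing pairs are those of the straight-line drawing. Both ends of a side
    have offsets 2 to 4, which fixes the gadget and leaves only its two connecting edges.\<close>
  have meet_T: "e = {6 * i, 6 * i + 1} \<or> e = {6 * i + 5, 6 * i + 6}"
    if f: "f \<in> ?T" and meet: "meet_at ?G L e f p" for e f p
  proof -
    obtain q where "meet_at ?G ?D e f q" using meet meet_iff by blast
    then have "\<exists>j<m. \<exists>(u, u', v, v', w)\<in>crossings.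
        e = {6 * j + u, 6 * j + u'} \<and> f = {6 * j + v, 6 * j + v'} \<and> q = of_nat (10 * j) + w"
      by (rule ring_meet[OF m])
    then obtain j u u' v v' w where c: "(u, u', v, v', w) \<in> crossings"
      and e: "e = {6 * j + u, 6 * j + u'}" and fj: "f = {6 * j + v, 6 * j + v'}" by auto
    have "6 * j + v \<in> {?a, ?b, ?c}" "6 * j + v' \<in> {?a, ?b, ?c}" using f fj by auto
    then obtain r r' where r: "2 \<le> r" "r \<le> 4" "6 * i + r = 6 * j + v"
      and r': "2 \<le> r'" "r' \<le> 4" "6 * i + r' = 6 * j + v'" by (auto elim!: meta_mp)
    have "j = i" using gadget_index(1)[of i r j v] r crossings_bounds(3)[OF c] by simp
    then have "v = r" "v' = r'" using r(3) r'(3) by simp_all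
    with c e r(1,2) r'(1,2) show ?thesis unfolding crossings_def \<open>j = i\<close>
      by (elim insertE emptyE) simp_all
  qed
  have apart: "path_image (curve L e) \<inter> J = {}"
    if e: "e \<in> edges ?G" "e \<inter> {?a, ?b, ?c} = {}" "e \<noteq> {6 * i, 6 * i + 1}" "e \<noteq> {6 * i + 5, 6 * i + 6}" for e
  proof -
    have "path_image (curve L e) \<inter> path_image (curve L f) = {}" if f: "f \<in> ?T" for f
    proof -
      have "f \<in> edges ?G" using f T by blast
      moreover have "e \<inter> f = {}" using e(2) f by blast
      moreover have "e \<noteq> f" using e(2) f by blast
      moreover have "\<not> meet_at ?G L e f p" for p using meet_T[OF f] e(3,4) by blast
      ultimately show ?thesis
        using edge_images_inter[OF simple_graph_ring L e(1)] by (metis image_empty subset_empty)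
    qed
    then show ?thesis unfolding J_def by blast
  qed
  have J_drawn: "J \<subseteq> drawn_set ?G L" unfolding J_def drawn_set_def using T by blast
  have along: "point L y \<in> outside J"
    if e: "{x, y} \<in> edges ?G" "{x, y} \<inter> {?a, ?b, ?c} = {}" "{x, y} \<noteq> {6 * i, 6 * i + 1}"
      "{x, y} \<noteq> {6 * i + 5, 6 * i + 6}" and x: "point L x \<in> outside J" for x y
  proof (rule same_side(2)[OF _ apart[OF e] _ _ x])
    show "connected (path_image (curve L {x, y}))"
      using L e(1) by (auto simp: is_drawing_def intro: connected_arc_image)
    show "point L x \<in> path_image (curve L {x, y})" "point L y \<in> path_image (curve L {x, y})"
      using point_on_edge[OF L e(1)] by auto
  qed
  have closing: "{0, 6 * m + 2} \<inter> {?a, ?b, ?c} = {}" "{0, 6 * m + 2} \<noteq> {6 * i, 6 * i + 1}"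
    "{0, 6 * m + 2} \<noteq> {6 * i + 5, 6 * i + 6}"
    using i by (auto simp: doubleton_eq_iff)
  \<comment> \<open>The vertex lies in the closure of the outer face. If it were in the open set
    \<open>inside J\<close>, this set would meet the outer face, which is part of
    \<open>outside J\<close> because \<open>J\<close> belongs to the drawing.\<close>
  have start: "point L (6 * m + 2) \<in> outside J"
  proof -
    let ?e = "{6 * m + 1, 6 * m + 2}" and ?O = "outside (drawn_set ?G L)"
    have e: "?e \<in> edges ?G" "6 * m + 2 \<in> ?e" by (rule outer_edges) simp
    have "(6 * m + 2, ?e) \<in> outer_face_boundary ?G L"
      using outer_edge_on_boundary[OF m] same by (simp only: same_embedding_def)
    then have "edge_part ?G L (6 * m + 2) ?e \<subseteq> frontier ?O" by (simp add: outer_face_boundary_def)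
    moreover have "point L (6 * m + 2) \<in> edge_part ?G L (6 * m + 2) ?e"
      using curve_from_props(3)[OF L e] by (force simp: edge_part_def pathstart_def)
    ultimately have cl: "point L (6 * m + 2) \<in> closure ?O" by (auto simp: frontier_def)
    have "point L (6 * m + 2) \<notin> inside J"
    proof
      assume "point L (6 * m + 2) \<in> inside J"
      then have "inside J \<inter> ?O \<noteq> {}"
        using cl J_Jordan(1) by (metis closure_iff_nhds_not_empty inf_commute order_refl)
      then show False using outside_mono[OF J_drawn] inside_Int_outside[of J] by blast
    qed
    moreover have "point L (6 * m + 2) \<notin> J"
      using apart[OF outer_edges(3) closing] point_on_edge[OF L outer_edges(3)] by blast
    ultimately show ?thesis using inside_Un_outside[of J] by blast
  qed
  have zero: "point L 0 \<in> outside J"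
    using along[of "6 * m + 2" 0, unfolded insert_commute[of "6 * m + 2" 0], OF outer_edges(3) closing start] .
  \<comment> \<open>From the closing vertices, the Hamiltonian cycle is followed towards gadget
    \<open>i\<close> from both ends. Neither walk uses a corner or a connecting edge of this gadget,
    so the side of \<open>J\<close> never changes.\<close>
  have left: "point L k \<in> outside J" if "k \<le> 6 * i" for k
    using that
  proof (induction k)
    case (Suc k)
    have "k < 6 * m + 2" using Suc.prems i by linarith
    then show ?case using Suc by (intro along[of k "Suc k"] ring_cycle) (auto simp: doubleton_eq_iff)
  qed (rule zero)
  have right: "point L k \<in> outside J" if "k \<le> 6 * m + 2" "6 * i + 6 \<le> k" for k
    using that
  proof (induction rule: inc_induct)
    case (step k)
    have "{Suc k, k} \<in> edges ?G" using ring_cycle[of k m] step.hyps by (simp add: insert_commute)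
    then show ?case using step by (intro along[of "Suc k" k]) (auto simp: doubleton_eq_iff)
  qed (rule start)
  have p: "point L (6 * i + 1) \<in> inside J"
  proof -
    have "\<exists>p. meet_at ?G ?D {?a, ?c} {6 * i + 0, 6 * i + 1} p"
      by (rule ring_meet_exists[OF m i, of _ _ _ _ 3]) (simp add: crossings_def)
    then have "\<exists>p. meet_at ?G L {?a, ?c} {6 * i, 6 * i + 1} p" unfolding meet_iff by (simp only: add_0_right)
    then obtain p where "meet_at ?G L {?a, ?c} {6 * i, 6 * i + 1} p" ..
    then have meet: "meet_at ?G L {?c, ?a} {6 * i, 6 * i + 1} p" unfolding flip .
    show ?thesis by (rule connector_end_inside[OF P C _ meet left[OF order_refl]]) auto
  qed
  have q: "point L (6 * i + 5) \<in> inside J"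
  proof -
    have "\<exists>p. meet_at ?G ?D {?a, ?b} {6 * i + 5, 6 * i + 6} p"
      by (rule ring_meet_exists[OF m i, of _ _ _ _ 7]) (simp add: crossings_def)
    \<comment> \<open>The connecting edge is written with its outer end \<open>6 * i + 6\<close>
      first, since the end already known to be outside has to precede the one to be located.\<close>
    then have "\<exists>p. meet_at ?G L {?a, ?b} {6 * i + 6, 6 * i + 5} p"
      unfolding meet_iff insert_commute[of "6 * i + 6"] .
    then obtain p where meet: "meet_at ?G L {?a, ?b} {6 * i + 6, 6 * i + 5} p" ..
    have s: "point L (6 * i + 6) \<in> outside J" by (rule right) (use i in auto)
    show ?thesis by (rule connector_end_inside[OF P C _ meet s]) auto
  qed
  show ?thesis
  proof (rule long_side[OF C])
    fix x assume x: "x \<in> {?a, ?b, ?c}"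
    then obtain r where r: "x = 6 * i + r" "r = 2 \<or> r = 3 \<or> r = 4" by auto
    then show "card (incident_edges ?G x) = 4" using gadget_degree[OF i, of r] by auto
    fix e assume e: "e \<in> incident_edges ?G x"
    then have eG: "e \<in> edges ?G" by (simp add: incident_edges_def)
    obtain s where s: "e = {x, 6 * i + s}" "(r, s) \<in> gadget_edges \<or> (s, r) \<in> gadget_edges"
      using e r incident_edges_gadget[OF i, of r] by auto
    then have "s \<in> {1, 2, 3, 4, 5}" "s \<noteq> r" using r(2) by (auto simp: gadget_edges_def)
    then consider "s = 1 \<or> s = 5" | "s \<in> {2, 3, 4}" by auto
    then show "path_image (curve L e) \<subseteq> J \<union> inside J"
    proof cases
      case 1
      then have y: "point L (6 * i + s) \<in> inside J" using p q by auto
      \<comment> \<open>This edge contains a corner, so it is not a connecting edge and crosses no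
        side. The crossing of 13 with 45 involves no side of the triangle.\<close>
      have "\<not> meet_at ?G L {x, 6 * i + s} f z" if "f \<in> ?T" for f z
      proof
        assume "meet_at ?G L {x, 6 * i + s} f z"
        then have "x \<in> {6 * i, 6 * i + 1} \<union> {6 * i + 5, 6 * i + 6}" using meet_T[OF that] by blast
        then show False using x by auto
      qed
      then show ?thesis unfolding s(1) using eG s(1) by (intro edge_to_inside[OF x _ y]) auto
    next
      case 2
      then have "e \<in> ?T" using s(1) r \<open>s \<noteq> r\<close> by auto
      then show ?thesis unfolding J_def by blast
    qed
  qed
qed

text \<open>The long side found in gadget \<open>i\<close> has its ends among the corners of that
  gadget. Corners of different gadgets are different vertices, so the sides found are pairwise
  distinct.\<close>

lemma ring_long_edges:
  assumes m: "m > 0" and resp: "respects_embedding (ring m) (ring_drawing m) L"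
    and C: "orthogonal_layout (ring m) L C"
  shows "m \<le> card {e \<in> edges (ring m). 4 \<le> complexity C e}"
proof -
  have "\<exists>e. e \<in> edges (ring m) \<and> 4 \<le> complexity C e \<and> e \<subseteq> {6 * i + 2..6 * i + 4} \<and> e \<noteq> {}" if i: "i < m" for i
  proof -
    obtain e where e: "e \<in> {{6 * i + 2, 6 * i + 3}, {6 * i + 3, 6 * i + 4}, {6 * i + 4, 6 * i + 2}}"
      "4 \<le> complexity C e"
      using gadget_long_edge[OF m i resp C] by blast
    moreover have "{6 * i + 2, 6 * i + 3} \<in> edges (ring m)" "{6 * i + 3, 6 * i + 4} \<in> edges (ring m)"
      "{6 * i + 2, 6 * i + 4} \<in> edges (ring m)"
      by (rule gadget_edge[OF i], simp add: gadget_edges_def)+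
    ultimately have "e \<in> edges (ring m)" by (auto simp only: insert_iff empty_iff insert_commute)
    then show ?thesis using e by (intro exI[of _ e]) auto
  qed
  then obtain g where g: "\<And>i. i < m \<Longrightarrow> g i \<in> edges (ring m) \<and> 4 \<le> complexity C (g i) \<and>
      g i \<subseteq> {6 * i + 2..6 * i + 4} \<and> g i \<noteq> {}" by metis
  have "inj_on g {..<m}"
  proof (rule inj_onI)
    fix i j assume ij: "i \<in> {..<m}" "j \<in> {..<m}" "g i = g j"
    then obtain x where "x \<in> {6 * i + 2..6 * i + 4}" "x \<in> {6 * j + 2..6 * j + 4}"
      using g[of i] g[of j] by (metis all_not_in_conv lessThan_iff subset_iff)
    then have "6 * i + 2 \<le> 6 * j + 4" "6 * j + 2 \<le> 6 * i + 4" by auto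
    then show "i = j" by linarith
  qed
  then have "m = card (g ` {..<m})" by (simp add: card_image)
  also have "\<dots> \<le> card {e \<in> edges (ring m). 4 \<le> complexity C e}"
    using g finite_edges_ring by (intro card_mono) auto
  finally show ?thesis .
qed

theorem theorem1:
  shows "(\<exists>(G :: nat graph) D.
            one_plane_graph G D \<and> biconnected G \<and> max_degree_le 4 G \<and>
            \<not> (\<exists>L C. respects_embedding G D L \<and> OC_layout 3 G L C)) \<and>
         (\<exists>(F :: (nat graph \<times> nat drawing) set) (c :: real).
            infinite ((\<lambda>(G, D). card (verts G)) ` F) \<and> c > 0 \<and>
            (\<forall>(G, D) \<in> F.
               one_plane_graph G D \<and> biconnected G \<and> max_degree_le 4 G \<and>
               (\<forall>L C. respects_embedding G D L \<and> OC_layout 4 G L C \<longrightarrow>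
                  real (card {e \<in> edges G. 4 \<le> complexity C e}) \<ge> c * real (card (verts G)))))"
proof
  have G: "one_plane_graph (ring m) (ring_drawing m) \<and> biconnected (ring m) \<and> max_degree_le 4 (ring m)"
    if "m > 0" for m
    using that simple_graph_ring one_planar_ring_drawing biconnected_ring max_degree_ring
    by (simp add: one_plane_graph_def)
  have "\<not> (respects_embedding (ring 1) (ring_drawing 1) L \<and> OC_layout 3 (ring 1) L C)" for L C
  proof
    assume *: "respects_embedding (ring 1) (ring_drawing 1) L \<and> OC_layout 3 (ring 1) L C"
    then have "1 \<le> card {e \<in> edges (ring 1). 4 \<le> complexity C e}"
      by (intro ring_long_edges) (auto simp: OC_layout_def)
    moreover have "{e \<in> edges (ring 1). 4 \<le> complexity C e} = {}" using * by (fastforce simp: OC_layout_def)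
    ultimately show False by (metis card.empty not_one_le_zero)
  qed
  then show "\<exists>(G :: nat graph) D. one_plane_graph G D \<and> biconnected G \<and> max_degree_le 4 G \<and>
      \<not> (\<exists>L C. respects_embedding G D L \<and> OC_layout 3 G L C)"
    using G[OF zero_less_one] by blast
  let ?F = "(\<lambda>m. (ring m, ring_drawing m)) ` {0<..}"
  have "(\<lambda>(G, D). card (verts G)) ` ?F = (\<lambda>m. 6 * m + 3) ` {0<..}"
    by (simp add: image_image numeral_3_eq_3)
  moreover have "infinite ((\<lambda>m :: nat. 6 * m + 3) ` {0<..})"
    by (subst finite_image_iff) (auto simp: inj_on_def infinite_Ioi)
  ultimately have inf: "infinite ((\<lambda>(G, D). card (verts G)) ` ?F)" by simp
  \<comment> \<open>The constant comes from \<open>6 * m + 3 \<le> 9 * m\<close>, valid for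
    \<open>m > 0\<close> and sharp at \<open>m = 1\<close>.\<close>
  have "real (card {e \<in> edges (ring m). 4 \<le> complexity C e}) \<ge> 1 / 9 * real (card (verts (ring m)))"
    if "m > 0" "respects_embedding (ring m) (ring_drawing m) L \<and> OC_layout 4 (ring m) L C" for m L C
  proof -
    have "m \<le> card {e \<in> edges (ring m). 4 \<le> complexity C e}"
      using that by (intro ring_long_edges) (auto simp: OC_layout_def)
    then show ?thesis using that(1) by simp
  qed
  then show "\<exists>(F :: (nat graph \<times> nat drawing) set) (c :: real).
      infinite ((\<lambda>(G, D). card (verts G)) ` F) \<and> c > 0 \<and>
      (\<forall>(G, D) \<in> F. one_plane_graph G D \<and> biconnected G \<and> max_degree_le 4 G \<and>
         (\<forall>L C. respects_embedding G D L \<and> OC_layout 4 G L C \<longrightarrow>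
            real (card {e \<in> edges G. 4 \<le> complexity C e}) \<ge> c * real (card (verts G))))"
    using inf G by (intro exI[of _ ?F] exI[of _ "1 / 9"]) auto
qed

end
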